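(* There is an absolute constant $c>0$ such that $r_5(6,4;n) > 2^{2^{c n^{1/4}}}$ for every integer $n>1$. Equivalently, for every $n>1$ there is a $5$-uniform hypergraph on more than $2^{2^{cn^{1/4}}}$ vertices with independence number less than $n$ in which every set of $6$ vertices induces at most $3$ edges.
   Context: For integers $2\leq k<n$ and $2\leq t\leq k+1$, $r_k(k+1,t;n)$ denotes the minimum integer $N$ such that for every red/blue coloring of the $k$-element subsets of $[N]=\{1,\dots,N\}$, there is either a set of $k+1$ integers at least $t$ of whose $k$-element subsets are colored red, or a set of $n$ integers all of whose $k$-element subsets are colored blue.
   Formalization: The bound on r_5(6,4;n) is proved for n>2 and the hypergraph form for n>3 instead of n>1, because r_5(6,4;2)=2 and any 3 vertices are independent in a 5-uniform hypergraph, so the claim fails for n=2 (and n=3 in the hypergraph form). *)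

theory Defs
  imports Complex_Main "HOL-Library.Ramsey"
begin

datatype colour = Red | Blue

text \<open>
  Colourings are total functions on finite sets of naturals, but only their values on
  the \<open>k\<close>-subsets of \<open>{1..N}\<close> matter below.
\<close>

definition ramsey_property :: "nat \<Rightarrow> nat \<Rightarrow> nat \<Rightarrow> nat \<Rightarrow> bool" where
  "ramsey_property k t n N \<longleftrightarrow>
     (\<forall>\<chi> :: nat set \<Rightarrow> colour.
        (\<exists>S \<in> nsets {1..N} (k + 1). t \<le> card {e \<in> nsets S k. \<chi> e = Red}) \<or>
        (\<exists>S \<in> nsets {1..N} n. \<forall>e \<in> nsets S k. \<chi> e = Blue))"

text \<open>The number \<open>r\<^sub>k(k+1,t;n)\<close>; the set of admissible \<open>N\<close> is nonempty, see below.\<close>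

definition ramsey_number :: "nat \<Rightarrow> nat \<Rightarrow> nat \<Rightarrow> nat" where
  "ramsey_number k t n = (LEAST N. ramsey_property k t n N)"

lemma ramsey_property_exists:
  assumes "t \<le> k + 1"
  shows "\<exists>N. ramsey_property k t n N"
proof -
  define N where "N = ES k (k + 1) n"
  have "ramsey_property k t n N"
    unfolding ramsey_property_def
  proof
    fix \<chi> :: "nat set \<Rightarrow> colour"
    define f where "f = (\<lambda>X. if \<chi> (Suc ` X) = Red then 0 else (1::nat))"
    have f: "f \<in> nsets {..<N} k \<rightarrow> {..<length [k + 1, n]}"
      by (auto simp: f_def)
    obtain i H where i: "i < length [k + 1, n]" and H: "H \<in> nsets {..<N} ([k + 1, n] ! i)"
      and mono: "f ` nsets H k \<subseteq> {i}"
      using ramsey2_full[of k "k + 1" n] f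
      unfolding partn_lst_def monochromatic_def N_def by blast
    define S where "S = Suc ` H"
    have S: "S \<in> nsets {1..N} ([k + 1, n] ! i)"
      using H by (auto simp: nsets_def S_def card_image)
    have col: "f X = i" if "X \<in> nsets H k" for X
      using mono that by blast
    have colS: "(\<chi> e = Red) \<longleftrightarrow> i = 0" if "e \<in> nsets S k" for e
    proof -
      have "e \<subseteq> Suc ` H" "card e = k" "finite e"
        using that by (simp_all add: nsets_def S_def)
      then obtain X where X: "X \<subseteq> H" "e = Suc ` X"
        by (meson subset_imageE)
      then have "X \<in> nsets H k"
        using \<open>card e = k\<close> \<open>finite e\<close>
        by (simp add: nsets_def card_image finite_image_iff)
      then show ?thesis
        using col[of X] X by (auto simp: f_def split: if_splits)
    qed
    show "(\<exists>S \<in> nsets {1..N} (k + 1). t \<le> card {e \<in> nsets S k. \<chi> e = Red}) \<or>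
        (\<exists>S \<in> nsets {1..N} n. \<forall>e \<in> nsets S k. \<chi> e = Blue)"
    proof (cases "i = 0")
      case True
      have SA: "S \<in> nsets {1..N} (k + 1)"
        using S True by simp
      then have "card S = k + 1"
        by (simp add: nsets_def)
      then have "card (nsets S k) = k + 1"
        by simp
      moreover have "{e \<in> nsets S k. \<chi> e = Red} = nsets S k"
        using colS True by auto
      ultimately have "t \<le> card {e \<in> nsets S k. \<chi> e = Red}"
        using assms by simp
      with SA show ?thesis by blast
    next
      case False
      then have "i = 1"
        using i by simp
      then have SA: "S \<in> nsets {1..N} n"
        using S by simp
      have "\<chi> e = Blue" if "e \<in> nsets S k" for e
        using colS[OF that] False by (cases "\<chi> e") simp_all
      with SA show ?thesis by blast
    qed
  qed
  then show ?thesis ..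
qed

definition uniform_hypergraph :: "nat \<Rightarrow> 'a set \<Rightarrow> 'a set set \<Rightarrow> bool" where
  "uniform_hypergraph k V E \<longleftrightarrow> finite V \<and> E \<subseteq> nsets V k"

definition induced_edges :: "'a set set \<Rightarrow> 'a set \<Rightarrow> 'a set set" where
  "induced_edges E S = {e \<in> E. e \<subseteq> S}"

definition independent_set :: "'a set \<Rightarrow> 'a set set \<Rightarrow> 'a set \<Rightarrow> bool" where
  "independent_set V E S \<longleftrightarrow> S \<subseteq> V \<and> induced_edges E S = {}"

definition independence_number :: "'a set \<Rightarrow> 'a set set \<Rightarrow> nat" where
  "independence_number V E = Max (card ` {S. independent_set V E S})"

end

theory Submission
  imports Defs "HOL-Library.FuncSet"
begin

text \<open>
  A stepping-up construction. The vertices are the numbers below \<open>2 ^ M\<close> with \<open>M = 2 ^ k\<close>, regarded as the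
  leaves of a binary tree, and \<open>lev x y\<close> is the position of the highest bit where \<open>x\<close> and \<open>y\<close> differ.
  A random digraph \<open>\<phi>\<close> on the \<open>M\<close> levels has, for \<open>m = 8 * k\<close>, the mixing property: among any \<open>m\<close> levels
  \<open>b\<close> and \<open>m\<close> disjoint pairs \<open>(x, y)\<close> some arc \<open>(b, x)\<close> is present while \<open>(b, y)\<close> is absent. Whether a
  5-set is an edge depends on its four consecutive levels and on \<open>\<phi>\<close> only, in such a way that the
  conditions for different 5-subsets of a 6-set exclude each other often enough.

  Let \<open>A\<close> be independent. By the mixing property it contains no comb (a subset with monotone
  consecutive levels) with more than \<open>6 * m\<close> vertices. Hence at the cost of a factor \<open>O(m)\<close> one passes
  to a subset in which distinct branchings have distinct levels. A further factor \<open>O(m)\<close> gives a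
  branching with two large halves, and each half of size \<open>\<Omega>(m\<^sup>2)\<close> has many disjoint pairs of levels, so
  the mixing property between the two halves produces an edge. Thus \<open>card A = O(m ^ 4)\<close>.
\<close>

subsection \<open>Levels and red sets\<close>

text \<open>Dropping \<open>j\<close> low bits moves from a leaf to its ancestor at height
  \<open>j\<close>, so this is the height of the lowest common ancestor. The lowest bit counts as 1,
  and 0 is left for equal vertices.\<close>

definition lev :: "nat \<Rightarrow> nat \<Rightarrow> nat" where
  "lev x y = (LEAST j. x div 2 ^ j = y div 2 ^ j)"

lemma lev_le_iff: "lev x y \<le> j \<longleftrightarrow> x div 2 ^ j = y div 2 ^ j"
proof -
  have "x < 2 ^ (x + y)" "y < 2 ^ (x + y)"
    using less_exp[of "x + y"] by linarith+
  then have ex: "x div 2 ^ (x + y) = y div 2 ^ (x + y)"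
    by simp
  have up: "x div 2 ^ j = y div 2 ^ j" if "x div 2 ^ i = y div 2 ^ i" "i \<le> j" for i j
    using that by (metis div_mult2_eq le_add_diff_inverse power_add)
  show ?thesis
    unfolding lev_def using up[OF LeastI[of "\<lambda>j. x div 2 ^ j = y div 2 ^ j", OF ex]]
      Least_le[of "\<lambda>j. x div 2 ^ j = y div 2 ^ j" j] by blast
qed

text \<open>Quotients by \<open>2 ^ j\<close> are monotone, so \<open>x\<close> and \<open>z\<close>
  can share one only if the quotient of \<open>y\<close>, squeezed between theirs, is the
  same.\<close>

lemma lev_trans:
  assumes "x \<le> y" "y \<le> z"
  shows "lev x z = max (lev x y) (lev y z)"
proof -
  have "lev x z \<le> j \<longleftrightarrow> lev x y \<le> j \<and> lev y z \<le> j" for j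
    using div_le_mono[OF assms(1), of "2 ^ j"] div_le_mono[OF assms(2), of "2 ^ j"]
    by (auto simp: lev_le_iff)
  then show ?thesis
    by (metis max.bounded_iff order_antisym order_refl)
qed

lemma lev_self: "lev x x = 0"
  using lev_le_iff[of x x 0] by simp

lemma lev_pos: "x < y \<Longrightarrow> 0 < lev x y"
  using lev_le_iff[of x y 0] by simp

text \<open>Just below a common level the three quotients would be strictly increasing and yet have
  the same half, whereas a node of the tree has only two children.\<close>

lemma lev_neq:
  assumes "x < y" "y < z"
  shows "lev x y \<noteq> lev y z"
proof
  assume eq: "lev x y = lev y z"
  obtain j where j: "lev x y = Suc j"
    using lev_pos[OF assms(1)] gr0_implies_Suc by blast
  define X Y Z where "X = x div 2 ^ j" and "Y = y div 2 ^ j" and "Z = z div 2 ^ j"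
  have "X \<noteq> Y" "Y \<noteq> Z"
    using eq j lev_le_iff[of x y j] lev_le_iff[of y z j] by (auto simp: X_def Y_def Z_def)
  moreover have "X \<le> Y" "Y \<le> Z"
    using assms by (auto simp: X_def Y_def Z_def div_le_mono)
  moreover have half: "w div 2 ^ j div 2 = w div 2 ^ Suc j" for w :: nat
    by (metis div_mult2_eq power_Suc2)
  have "X div 2 = Y div 2" "Y div 2 = Z div 2"
    unfolding X_def Y_def Z_def half
    using eq j lev_le_iff[of x y "Suc j"] lev_le_iff[of y z "Suc j"] by auto
  ultimately show False
    by linarith
qed

lemma lev_le_exp: "x < 2 ^ M \<Longrightarrow> y < 2 ^ M \<Longrightarrow> lev x y \<le> M"
  by (simp add: lev_le_iff)

lemma lev_mono:
  assumes "x \<le> u" "u \<le> v" "v \<le> y"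
  shows "lev u v \<le> lev x y"
  using lev_trans[of x u y] lev_trans[of u v y] assms by simp

text \<open>The levels \<open>a\<close> and \<open>b\<close> tell \<open>c\<close> and
  \<open>d\<close> apart in opposite ways. This lets two 5-subsets of a 6-vertex comb make
  contradictory demands on one arc.\<close>

definition descent :: "(nat \<Rightarrow> nat set) \<Rightarrow> nat \<Rightarrow> nat \<Rightarrow> nat \<Rightarrow> nat \<Rightarrow> bool" where
  "descent \<phi> a b c d \<longleftrightarrow> a > b \<and> b > c \<and> c > d \<and>
     c \<in> \<phi> a \<and> d \<notin> \<phi> a \<and> c \<notin> \<phi> b \<and> d \<in> \<phi> b"

text \<open>
  Let \<open>p, q, r, s\<close> be the levels of the consecutive pairs of a 5-set. The first two cases are the
  5-sets whose binary tree is a comb, the next two those whose root level is \<open>q\<close>, with a right half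
  that is a left comb; the last one is the mirror image of the fourth.
\<close>

definition red_levels :: "(nat \<Rightarrow> nat set) \<Rightarrow> nat \<Rightarrow> nat \<Rightarrow> nat \<Rightarrow> nat \<Rightarrow> bool" where
  "red_levels \<phi> p q r s \<longleftrightarrow> descent \<phi> p q r s \<or> descent \<phi> s r q p \<or>
     q > s \<and> s = p \<and> p > r \<or>
     q > s \<and> s > r \<and> r > p \<and> s \<in> \<phi> p \<and> r \<notin> \<phi> p \<or>
     r > p \<and> p > q \<and> q > s \<and> p \<in> \<phi> s \<and> q \<notin> \<phi> s"

text \<open>Here and in the next three lemmas \<open>d1\<close>, ..., \<open>d5\<close> are the
  consecutive levels of a 6-set, and the numbers in the name are the positions of the deleted
  vertices. Deleting an inner vertex merges its two levels into their maximum. Every combination of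
  cases fails because of the order of the levels or because one arc is both demanded and
  excluded.\<close>

lemma red_levels_conflict_1_4:
  assumes "d3 \<noteq> d4" and "red_levels \<phi> d2 d3 d4 d5" "red_levels \<phi> d1 d2 (max d3 d4) d5"
  shows False
proof -
  consider (l) "d3 < d4" | (g) "d4 < d3"
    using assms(1) by linarith
  then show False
  proof cases
    case l
    then have "red_levels \<phi> d1 d2 d4 d5"
      using assms(3) by simp
    with l assms(2) show False
      unfolding red_levels_def descent_def by (elim conjE disjE; (linarith | (simp; fail)))
  next
    case g
    then have "red_levels \<phi> d1 d2 d3 d5"
      using assms(3) by simp
    with g assms(2) show False
      unfolding red_levels_def descent_def by (elim conjE disjE; (linarith | (simp; fail)))
  qed
qed

lemma red_levels_conflict_2_5:
  assumes "d1 \<noteq> d2" "d4 \<noteq> d5" and "red_levels \<phi> (max d1 d2) d3 d4 d5" "red_levels \<phi> d1 d2 d3 (max d4 d5)"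
  shows False
proof -
  obtain a where a: "a = max d1 d2" "d1 < a \<and> a = d2 \<or> d2 < a \<and> a = d1"
    using assms(1) by (auto simp: max_def)
  obtain b where b: "b = max d4 d5" "d4 < b \<and> b = d5 \<or> d5 < b \<and> b = d4"
    using assms(2) by (auto simp: max_def)
  from a(2) b(2) assms(3,4)[folded a(1) b(1)] show False
    unfolding red_levels_def descent_def by (elim conjE disjE; (linarith | (simp; fail)))
qed

lemma red_levels_conflict_1_3_6:
  assumes "d2 \<noteq> d3" and "red_levels \<phi> d2 d3 d4 d5" "red_levels \<phi> d1 (max d2 d3) d4 d5" "red_levels \<phi> d1 d2 d3 d4"
  shows False
proof -
  obtain a where a: "a = max d2 d3" "d2 < a \<and> a = d3 \<or> d3 < a \<and> a = d2"
    using assms(1) by (auto simp: max_def)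
  from a(2) assms(2) assms(3)[folded a(1)] assms(4) show False
    unfolding red_levels_def descent_def by (elim conjE disjE; (linarith | (simp; fail)))
qed

lemma red_levels_conflict_3_4_6:
  assumes "d2 \<noteq> d3" "d3 \<noteq> d4"
    and "red_levels \<phi> d1 (max d2 d3) d4 d5" "red_levels \<phi> d1 d2 (max d3 d4) d5" "red_levels \<phi> d1 d2 d3 d4"
  shows False
proof -
  obtain a where a: "a = max d2 d3" "d2 < a \<and> a = d3 \<or> d3 < a \<and> a = d2"
    using assms(1) by (auto simp: max_def)
  obtain b where b: "b = max d3 d4" "d3 < b \<and> b = d4 \<or> d4 < b \<and> b = d3"
    using assms(2) by (auto simp: max_def)
  from a(2) b(2) assms(3,4)[folded a(1) b(1)] assms(5) show False
    unfolding red_levels_def descent_def by (elim conjE disjE; (linarith | (simp; fail)))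
qed

section \<open>Red 5-sets and their number inside a 6-set\<close>

definition red_set :: "(nat \<Rightarrow> nat set) \<Rightarrow> nat set \<Rightarrow> bool" where
  "red_set \<phi> e \<longleftrightarrow> (\<exists>p q r s t. p < q \<and> q < r \<and> r < s \<and> s < t \<and> e = {p, q, r, s, t} \<and>
     red_levels \<phi> (lev p q) (lev q r) (lev r s) (lev s t))"

text \<open>A finite set has only one increasing enumeration, so the witnesses in
  \<open>red_set\<close> must be the given vertices.\<close>

lemma red_set_iff:
  assumes "p < q" "q < r" "r < s" "s < t"
  shows "red_set \<phi> {p, q, r, s, t} \<longleftrightarrow> red_levels \<phi> (lev p q) (lev q r) (lev r s) (lev s t)"
proof -
  have list: "sorted_list_of_set {p', q', r', s', t'} = [p', q', r', s', t']"
    if "p' < q'" "q' < r'" "r' < s'" "s' < t'" for p' q' r' s' t' :: nat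
  proof -
    have "sorted_list_of_set (set [p', q', r', s', t']) = [p', q', r', s', t']"
      using that by (intro sorted_list_of_set.idem_if_sorted_distinct) simp_all
    then show ?thesis
      by (simp only: list.set)
  qed
  show ?thesis
  proof
    assume "red_set \<phi> {p, q, r, s, t}"
    then obtain p' q' r' s' t' where *: "p' < q'" "q' < r'" "r' < s'" "s' < t'"
      "{p, q, r, s, t} = {p', q', r', s', t'}" "red_levels \<phi> (lev p' q') (lev q' r') (lev r' s') (lev s' t')"
      unfolding red_set_def by blast
    have "[p, q, r, s, t] = [p', q', r', s', t']"
      using arg_cong[OF *(5), of sorted_list_of_set] by (simp only: list[OF assms] list[OF *(1-4)])
    with *(6) show "red_levels \<phi> (lev p q) (lev q r) (lev r s) (lev s t)"
      by simp
  qed (use assms in \<open>unfold red_set_def, blast\<close>)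
qed

lemma red_set_card: "red_set \<phi> e \<Longrightarrow> finite e \<and> card e = 5"
  unfolding red_set_def by force

text \<open>At most one of \<open>A\<close>, \<open>D\<close> and one of \<open>B\<close>,
  \<open>E\<close> holds, so a sum of four would need \<open>C\<close>, \<open>F\<close> and one of
  \<open>A\<close>, \<open>D\<close>. The last two hypotheses exclude this.\<close>

lemma sum_of_bool_le_3:
  assumes "\<not> (A \<and> D)" "\<not> (B \<and> E)" "\<not> (A \<and> C \<and> F)" "\<not> (C \<and> D \<and> F)"
  shows "of_bool A + of_bool B + of_bool C + of_bool D + of_bool E + of_bool F \<le> (3 :: nat)"
  using assms by (cases A; cases B; cases C) auto

lemma card_red_sets_le:
  assumes "finite S" "card S = 6"
  shows "card {e. e \<subseteq> S \<and> red_set \<phi> e} \<le> 3"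
proof -
  define l where "l = sorted_list_of_set S"
  have l: "length l = 6" "sorted l" "distinct l" "set l = S"
    using assms by (simp_all add: l_def)
  then obtain u v w x y z where "l = [u, v, w, x, y, z]"
    by (auto simp: numeral_eq_Suc length_Suc_conv)
  with l have o: "u < v" "v < w" "w < x" "x < y" "y < z" and S: "S = {u, v, w, x, y, z}"
    by (auto simp: order.strict_iff_order)
  note d = lev_neq[OF o(1,2)] lev_neq[OF o(2,3)] lev_neq[OF o(3,4)] lev_neq[OF o(4,5)]
  \<comment> \<open>Each of the six 5-subsets contributes a list of length zero or one, so the
    length of the concatenation is a sum of truth values.\<close>
  define f where "f = (\<lambda>Q (e :: nat set). if Q then [e] else [])"
  have f_length: "length (f Q e) = of_bool Q" for Q e
    by (simp add: f_def)
  let ?d1 = "lev u v" and ?d2 = "lev v w" and ?d3 = "lev w x" and ?d4 = "lev x y" and ?d5 = "lev y z"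
  let ?A = "red_levels \<phi> ?d2 ?d3 ?d4 ?d5" and ?B = "red_levels \<phi> (max ?d1 ?d2) ?d3 ?d4 ?d5"
   and ?C = "red_levels \<phi> ?d1 (max ?d2 ?d3) ?d4 ?d5" and ?D = "red_levels \<phi> ?d1 ?d2 (max ?d3 ?d4) ?d5"
   and ?E = "red_levels \<phi> ?d1 ?d2 ?d3 (max ?d4 ?d5)" and ?F = "red_levels \<phi> ?d1 ?d2 ?d3 ?d4"
  let ?es = "f ?A {v, w, x, y, z} @ f ?B {u, w, x, y, z} @ f ?C {u, v, x, y, z}
    @ f ?D {u, v, w, y, z} @ f ?E {u, v, w, x, z} @ f ?F {u, v, w, x, y}"
  have sub: "{e. e \<subseteq> S \<and> red_set \<phi> e} \<subseteq> set ?es"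
  proof
    fix e assume "e \<in> {e. e \<subseteq> S \<and> red_set \<phi> e}"
    then have e: "e \<subseteq> S" "red_set \<phi> e" "finite e" "card e = 5"
      using red_set_card by auto
    then have "card (S - e) = 1"
      using assms by (simp add: card_Diff_subset)
    then obtain a where "S - e = {a}"
      using card_1_singletonE by blast
    then have ea: "e = S - {a}" "a \<in> S"
      using e(1) by auto
    have m: "max (lev a b) (lev b c) = lev a c" if "a < b" "b < c" for a b c
      using lev_trans[of a b c] that by simp
    have in_f: "e \<in> set (f Q e)" if Q for Q e
      using that by (simp add: f_def)
    consider "a = u" | "a = v" | "a = w" | "a = x" | "a = y" | "a = z"
      using ea(2) unfolding S by blast
    then show "e \<in> set ?es"
    proof cases
      assume "a = u"
      then have es: "e = {v, w, x, y, z}"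
        using ea(1) o unfolding S by auto
      have ?A
        using e(2) red_set_iff[of v w x y z \<phi>] o  unfolding es by simp
      from in_f[OF this] show ?thesis
        unfolding es by (simp only: set_append Un_iff simp_thms)
    next
      assume "a = v"
      then have es: "e = {u, w, x, y, z}"
        using ea(1) o unfolding S by auto
      have ?B
        using e(2) red_set_iff[of u w x y z \<phi>] o m[of u v w] unfolding es by simp
      from in_f[OF this] show ?thesis
        unfolding es by (simp only: set_append Un_iff simp_thms)
    next
      assume "a = w"
      then have es: "e = {u, v, x, y, z}"
        using ea(1) o unfolding S by auto
      have ?C
        using e(2) red_set_iff[of u v x y z \<phi>] o m[of v w x] unfolding es by simp
      from in_f[OF this] show ?thesis
        unfolding es by (simp only: set_append Un_iff simp_thms)
    next
      assume "a = x"
      then have es: "e = {u, v, w, y, z}"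
        using ea(1) o unfolding S by auto
      have ?D
        using e(2) red_set_iff[of u v w y z \<phi>] o m[of w x y] unfolding es by simp
      from in_f[OF this] show ?thesis
        unfolding es by (simp only: set_append Un_iff simp_thms)
    next
      assume "a = y"
      then have es: "e = {u, v, w, x, z}"
        using ea(1) o unfolding S by auto
      have ?E
        using e(2) red_set_iff[of u v w x z \<phi>] o m[of x y z] unfolding es by simp
      from in_f[OF this] show ?thesis
        unfolding es by (simp only: set_append Un_iff simp_thms)
    next
      assume "a = z"
      then have es: "e = {u, v, w, x, y}"
        using ea(1) o unfolding S by auto
      have ?F
        using e(2) red_set_iff[of u v w x y \<phi>] o  unfolding es by simp
      from in_f[OF this] show ?thesis
        unfolding es by (simp only: set_append Un_iff simp_thms)
    qed
  qed
  have "card {e. e \<subseteq> S \<and> red_set \<phi> e} \<le> length ?es"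
    by (rule order.trans[OF card_mono[OF _ sub] card_length]) simp
  also have "\<dots> = of_bool ?A + of_bool ?B + of_bool ?C + of_bool ?D + of_bool ?E + of_bool ?F"
    by (simp only: length_append f_length add.assoc)
  also have "\<dots> \<le> 3"
  proof (rule sum_of_bool_le_3)
    show "\<not> (?A \<and> ?D)" using red_levels_conflict_1_4[OF d(3)] by blast
    show "\<not> (?B \<and> ?E)" using red_levels_conflict_2_5[OF d(1,4)] by blast
    show "\<not> (?A \<and> ?C \<and> ?F)" using red_levels_conflict_1_3_6[OF d(2)] by blast
    show "\<not> (?C \<and> ?D \<and> ?F)" using red_levels_conflict_3_4_6[OF d(2,3)] by blast
  qed
  finally show ?thesis .
qed

subsection \<open>Mixing digraphs\<close>

definition disjoint_pairs :: "('a \<times> 'a) set \<Rightarrow> bool" where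
  "disjoint_pairs P \<longleftrightarrow> (\<forall>p\<in>P. fst p \<noteq> snd p) \<and>
     (\<forall>p\<in>P. \<forall>q\<in>P. p \<noteq> q \<longrightarrow> {fst p, snd p} \<inter> {fst q, snd q} = {})"

text \<open>The pairs are ordered. Swapping the components of all pairs yields an arc to
  \<open>y\<close> without an arc to \<open>x\<close>, and \<open>descent\<close> needs both
  kinds.\<close>

definition mixing :: "'a set \<Rightarrow> nat \<Rightarrow> ('a \<Rightarrow> 'a set) \<Rightarrow> bool" where
  "mixing U m \<phi> \<longleftrightarrow> (\<forall>B P. B \<subseteq> U \<and> card B = m \<and> P \<subseteq> U \<times> U \<and> card P = m \<and> disjoint_pairs P \<longrightarrow>
     (\<exists>b\<in>B. \<exists>(x, y)\<in>P. x \<in> \<phi> b \<and> y \<notin> \<phi> b))"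

text \<open>Each disjoint pair leaves three of the four possible traces on it.\<close>

lemma card_no_split_le:
  assumes "finite P" "finite U" "P \<subseteq> U \<times> U" "disjoint_pairs P"
  shows "card {r. r \<subseteq> U \<and> (\<forall>(x, y)\<in>P. x \<in> r \<longrightarrow> y \<in> r)} * 4 ^ card P \<le> 3 ^ card P * 2 ^ card U"
  using assms
proof (induction P arbitrary: U rule: finite_induct)
  case empty
  have "{r. r \<subseteq> U} = Pow U"
    by auto
  then show ?case
    using empty by (simp add: card_Pow)
next
  case (insert p P)
  obtain x y where p: "p = (x, y)"
    by (cases p)
  define V where "V = U - {x, y}"
  let ?G = "\<lambda>U P. {r. r \<subseteq> U \<and> (\<forall>(x, y)\<in>P. x \<in> r \<longrightarrow> y \<in> r)}"
  have xy: "x \<noteq> y" "x \<in> U" "y \<in> U"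
    using insert.prems p by (auto simp: disjoint_pairs_def)
  have dis: "{x, y} \<inter> {fst q, snd q} = {}" if "q \<in> P" for q
  proof -
    have "q \<noteq> p"
      using that insert.hyps by blast
    then show ?thesis
      using insert.prems(3) that p unfolding disjoint_pairs_def by auto
  qed
  have P: "P \<subseteq> V \<times> V"
  proof
    fix q assume "q \<in> P"
    moreover obtain a b where "q = (a, b)"
      by (cases q)
    ultimately show "q \<in> V \<times> V"
      using dis[of q] insert.prems(2) by (auto simp: V_def)
  qed
  have dP: "disjoint_pairs P"
    using insert.prems(3) by (auto simp: disjoint_pairs_def)
  have IH: "card (?G V P) * 4 ^ card P \<le> 3 ^ card P * 2 ^ card V"
    using insert.IH[of V] P dP insert.prems(1) by (simp add: V_def)
  have finV: "finite (?G V P)"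
    using insert.prems(1) by (rule_tac finite_subset[of _ "Pow V"]) (auto simp: V_def)
  have "card (?G U (insert p P)) \<le> card (?G V P \<times> {{}, {y}, {x, y}})"
  proof (rule card_inj_on_le)
    let ?f = "\<lambda>r. (r \<inter> V, r \<inter> {x, y})"
    show "inj_on ?f (?G U (insert p P))"
    proof (rule inj_onI)
      fix r s assume "r \<in> ?G U (insert p P)" "s \<in> ?G U (insert p P)" "?f r = ?f s"
      then have "r \<subseteq> U" "s \<subseteq> U" "r \<inter> V = s \<inter> V" "r \<inter> {x, y} = s \<inter> {x, y}"
        by auto
      then show "r = s"
        unfolding V_def by blast
    qed
    show "?f ` ?G U (insert p P) \<subseteq> ?G V P \<times> {{}, {y}, {x, y}}"
    proof
      fix z assume "z \<in> ?f ` ?G U (insert p P)"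
      then obtain r where r: "z = ?f r" "r \<subseteq> U" "\<forall>(x, y)\<in>insert p P. x \<in> r \<longrightarrow> y \<in> r"
        by auto
      have "r \<inter> {x, y} \<in> {{}, {y}, {x, y}}"
        using r(3) p by auto
      moreover have "r \<inter> V \<in> ?G V P"
        using r(3) P by auto
      ultimately show "z \<in> ?G V P \<times> {{}, {y}, {x, y}}"
        using r(1) by blast
    qed
    show "finite (?G V P \<times> {{}, {y}, {x, y}})"
      using finV by simp
  qed
  also have "\<dots> = card (?G V P) * 3"
    using xy by (simp add: card_cartesian_product doubleton_eq_iff card_insert_if)
  finally have "card (?G U (insert p P)) * 4 ^ card (insert p P) \<le> (card (?G V P) * 3) * 4 ^ card (insert p P)"
    by (rule mult_le_mono1)
  also have "\<dots> = (card (?G V P) * 4 ^ card P) * 12"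
    using insert.hyps by simp
  also have "\<dots> \<le> (3 ^ card P * 2 ^ card V) * 12"
    using IH by (rule mult_le_mono1)
  also have "\<dots> = 3 ^ card (insert p P) * 2 ^ card U"
  proof -
    have "card V + 2 = card U"
      using xy insert.prems(1) card_mono[of U "{x, y}"] by (simp add: V_def card_Diff_subset)
    then have "2 ^ card U = (2 ^ card V * 4 :: nat)"
      by (metis power2_eq_square power_add num_double numeral_times_numeral)
    then show ?thesis
      using insert.hyps by simp
  qed
  finally show ?case .
qed

text \<open>Union bound by counting. For fixed \<open>B\<close> and \<open>P\<close> all
  \<open>m\<close> out-neighbourhoods of \<open>B\<close> must fail on all \<open>m\<close> pairs,
  which leaves at most a fraction \<open>(3 / 4) ^ (m * m)\<close> of the digraphs, while there are
  at most \<open>8 ^ (k * m)\<close> choices of \<open>B\<close> and \<open>P\<close>.\<close>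

lemma mixing_exists:
  assumes "finite U" "card U = 2 ^ k" "k > 0"
  shows "\<exists>\<phi>. mixing U (8 * k) \<phi>"
proof (rule ccontr)
  assume none: "\<nexists>\<phi>. mixing U (8 * k) \<phi>"
  define m where "m = 8 * k"
  define \<B> where "\<B> = {B. B \<subseteq> U \<and> card B = m}"
  define \<P> where "\<P> = {P. P \<subseteq> U \<times> U \<and> card P = m \<and> disjoint_pairs P}"
  define bad where "bad = (\<lambda>P. {r. r \<subseteq> U \<and> (\<forall>(x, y)\<in>P. x \<in> r \<longrightarrow> y \<in> r)})"
  \<comment> \<open>The digraphs on which \<open>B\<close> and \<open>P\<close> fail. Extensional
    functions are used so that there are finitely many digraphs to count.\<close>
  define F where "F = (\<lambda>(B, P). PiE U (\<lambda>b. if b \<in> B then bad P else Pow U))"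
  have fin_bad: "finite (bad P)" for P
    using assms(1) by (rule_tac finite_subset[of _ "Pow U"]) (auto simp: bad_def)
  have fin: "finite \<B>" "finite \<P>"
    using assms(1) by (auto simp: \<B>_def \<P>_def intro: finite_subset[of _ "Pow U"] finite_subset[of _ "Pow (U \<times> U)"])
  have cF: "card (F (B, P)) * 4 ^ (m * m) \<le> 3 ^ (m * m) * 2 ^ (card U * card U)" if "B \<in> \<B>" "P \<in> \<P>" for B P
  proof -
    have B: "B \<subseteq> U" "card B = m" and P: "P \<subseteq> U \<times> U" "card P = m" "disjoint_pairs P" "finite P"
      using that assms(1) by (auto simp: \<B>_def \<P>_def intro: finite_subset[of _ "U \<times> U"])
    have "card (F (B, P)) = (\<Prod>b\<in>U. card (if b \<in> B then bad P else Pow U))"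
      using assms(1) by (simp add: F_def card_PiE)
    also have "\<dots> = (\<Prod>b\<in>U. if b \<in> B then card (bad P) else card (Pow U))"
      by (intro prod.cong) auto
    also have "\<dots> = card (bad P) ^ m * (2 ^ card U) ^ (card U - m)"
    proof -
      have "U \<inter> {b. b \<in> B} = B" "U \<inter> - {b. b \<in> B} = U - B"
        using B(1) by auto
      then show ?thesis
        using assms(1) B card_Diff_subset[of B U] finite_subset[OF B(1) assms(1)]
        by (simp add: prod.If_cases card_Pow)
    qed
    finally have "card (F (B, P)) * 4 ^ (m * m) = (card (bad P) * 4 ^ m) ^ m * (2 ^ card U) ^ (card U - m)"
      by (simp add: power_mult_distrib power_mult)
    also have "\<dots> \<le> (3 ^ m * 2 ^ card U) ^ m * (2 ^ card U) ^ (card U - m)"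
      using card_no_split_le[OF P(4) assms(1) P(1,3)] P(2)
      by (intro mult_le_mono1 power_mono) (simp_all add: bad_def)
    also have "\<dots> = 3 ^ (m * m) * (2 ^ card U) ^ (m + (card U - m))"
      by (simp only: power_mult_distrib power_mult power_add mult.assoc)
    also have "m + (card U - m) = card U"
      using card_mono[OF assms(1) B(1)] B(2) by simp
    finally show ?thesis
      by (simp only: power_mult)
  qed
  have "PiE U (\<lambda>_. Pow U) \<subseteq> (\<Union>z\<in>\<B> \<times> \<P>. F z)"
  proof
    fix \<phi> assume \<phi>: "\<phi> \<in> PiE U (\<lambda>_. Pow U)"
    have "\<not> mixing U m \<phi>"
      using none by (simp add: m_def)
    then obtain B P where *: "B \<in> \<B>" "P \<in> \<P>" "\<not> (\<exists>b\<in>B. \<exists>(x, y)\<in>P. x \<in> \<phi> b \<and> y \<notin> \<phi> b)"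
      unfolding mixing_def \<B>_def \<P>_def by (simp only: not_all not_imp mem_Collect_eq) metis
    have "\<phi> \<in> F (B, P)"
      using \<phi> *(3) by (auto simp: F_def bad_def PiE_iff)
    with * show "\<phi> \<in> (\<Union>z\<in>\<B> \<times> \<P>. F z)"
      by blast
  qed
  then have "card (PiE U (\<lambda>_. Pow U)) \<le> card (\<Union>z\<in>\<B> \<times> \<P>. F z)"
    using fin fin_bad assms(1) by (intro card_mono) (auto simp: F_def intro!: finite_PiE)
  also have "\<dots> \<le> (\<Sum>z\<in>\<B> \<times> \<P>. card (F z))"
    using fin by (intro card_UN_le) simp
  finally have "card (PiE U (\<lambda>_. Pow U)) * 4 ^ (m * m) \<le> (\<Sum>z\<in>\<B> \<times> \<P>. card (F z) * 4 ^ (m * m))"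
    by (simp add: sum_distrib_right[symmetric])
  also have "\<dots> \<le> (\<Sum>z\<in>\<B> \<times> \<P>. 3 ^ (m * m) * 2 ^ (card U * card U))"
    using cF by (intro sum_mono) auto
  also have "\<dots> = card \<B> * card \<P> * 3 ^ (m * m) * 2 ^ (card U * card U)"
    by (simp add: card_cartesian_product)
  also have "\<dots> \<le> (2 ^ k) ^ m * (2 ^ k * 2 ^ k) ^ m * 3 ^ (m * m) * 2 ^ (card U * card U)"
  proof (intro mult_le_mono1 mult_le_mono)
    have choose: "n choose m \<le> n ^ m" for n
      by (cases "m \<le> n") (simp_all add: binomial_le_pow binomial_eq_0)
    show "card \<B> \<le> (2 ^ k) ^ m"
      using choose n_subsets[OF assms(1), of m] assms(2) by (simp add: \<B>_def)
    have "card \<P> \<le> card {P. P \<subseteq> U \<times> U \<and> card P = m}"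
      using assms(1) by (intro card_mono) (auto simp: \<P>_def intro: finite_subset[of _ "Pow (U \<times> U)"])
    also have "\<dots> \<le> (2 ^ k * 2 ^ k) ^ m"
      using choose n_subsets[of "U \<times> U" m] assms(1,2) by (simp add: card_cartesian_product)
    finally show "card \<P> \<le> (2 ^ k * 2 ^ k) ^ m" .
  qed
  finally have "card (PiE U (\<lambda>_. Pow U)) * 4 ^ (m * m)
      \<le> (2 ^ k) ^ m * (2 ^ k * 2 ^ k) ^ m * 3 ^ (m * m) * 2 ^ (card U * card U)" .
  moreover have "card (PiE U (\<lambda>_. Pow U)) = 2 ^ (card U * card U)"
    using assms(1) by (simp add: card_PiE card_Pow flip: power_mult)
  ultimately have "2 ^ (card U * card U) * 4 ^ (m * m)
      \<le> ((2 ^ k) ^ m * (2 ^ k * 2 ^ k) ^ m * 3 ^ (m * m)) * (2 :: nat) ^ (card U * card U)"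
    by (simp only:)
  then have "4 ^ (m * m) \<le> (2 ^ k) ^ m * (2 ^ k * 2 ^ k) ^ m * (3 :: nat) ^ (m * m)"
    by simp
  also have "\<dots> = (2 ^ k * (2 ^ k * 2 ^ k) * 3 ^ m) ^ m"
    by (simp only: power_mult_distrib power_mult)
  finally have "(4 ^ m) ^ m \<le> (2 ^ k * (2 ^ k * 2 ^ k) * (3 :: nat) ^ m) ^ m"
    by (simp only: power_mult)
  moreover have "(2 ^ k * (2 ^ k * 2 ^ k) * (3 :: nat) ^ m) ^ m < (4 ^ m) ^ m"
  proof (rule power_strict_mono)
    \<comment> \<open>Origin of the factor in \<open>8 * k\<close>: the least exponent
      \<open>j\<close> with \<open>8 * 3 ^ j < 4 ^ j\<close> is 8.\<close>
    have "2 ^ k * (2 ^ k * 2 ^ k) * (3 :: nat) ^ m = (2 * (2 * 2) * 3 ^ 8) ^ k"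
      by (simp only: m_def power_mult power_mult_distrib)
    also have "\<dots> < (4 ^ 8) ^ k"
      using assms(3) by (intro power_strict_mono) simp_all
    finally show "2 ^ k * (2 ^ k * 2 ^ k) * (3 :: nat) ^ m < 4 ^ m"
      by (simp only: m_def power_mult)
  qed (use assms(3) in \<open>simp_all add: m_def\<close>)
  ultimately show False
    by simp
qed

subsection \<open>Blocks and splittings\<close>

lemma obtain_lower_subset:
  fixes X :: "nat set"
  assumes "finite X" "k \<le> card X"
  obtains L where "L \<subseteq> X" "card L = k" "\<And>x y. x \<in> L \<Longrightarrow> y \<in> X - L \<Longrightarrow> x < y"
proof -
  have "\<exists>L\<subseteq>X. card L = k \<and> (\<forall>x\<in>L. \<forall>y\<in>X - L. x < y)"
    using assms(2)
  proof (induction k)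
    case 0
    then show ?case
      by (intro exI[of _ "{}"]) simp
  next
    case (Suc k)
    then obtain L where L: "L \<subseteq> X" "card L = k" "\<forall>x\<in>L. \<forall>y\<in>X - L. x < y"
      by auto
    have fL: "finite L" "finite (X - L)"
      using L(1) assms(1) finite_subset by auto
    have ne: "X - L \<noteq> {}"
      using Suc.prems L(1,2) by auto
    define z where "z = Min (X - L)"
    have z: "z \<in> X - L" "\<And>y. y \<in> X - L \<Longrightarrow> z \<le> y"
      using Min_in[OF fL(2) ne] Min_le[OF fL(2)] by (simp_all add: z_def)
    have "card (insert z L) = Suc k" "insert z L \<subseteq> X"
      using z(1) fL(1) L(1,2) by auto
    moreover have "x < y" if "x \<in> insert z L" "y \<in> X - insert z L" for x y
      using that L(3) z by (cases "x = z") (auto simp: le_neq_implies_less)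
    ultimately show ?case
      by blast
  qed
  then show ?thesis
    using that by blast
qed

lemma obtain_blocks:
  fixes X :: "nat set"
  assumes "finite X" "m * k \<le> card X"
  obtains f where "\<And>i. i < m \<Longrightarrow> f i \<subseteq> X \<and> card (f i) = k"
    "\<And>i j x y. i < j \<Longrightarrow> j < m \<Longrightarrow> x \<in> f i \<Longrightarrow> y \<in> f j \<Longrightarrow> x < y"
proof -
  have "\<exists>f. (\<forall>i<m. f i \<subseteq> X \<and> card (f i) = k) \<and>
      (\<forall>i j. i < j \<longrightarrow> j < m \<longrightarrow> (\<forall>x\<in>f i. \<forall>y\<in>f j. x < y))"
    using assms
  proof (induction m arbitrary: X)
    case (Suc m)
    then have "k \<le> card X"
      by simp
    from obtain_lower_subset[OF Suc.prems(1) this]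
    obtain L where L: "L \<subseteq> X" "card L = k" "\<And>x y. x \<in> L \<Longrightarrow> y \<in> X - L \<Longrightarrow> x < y"
      by blast
    have "m * k \<le> card (X - L)"
      using Suc.prems L(1,2) finite_subset[OF L(1)] by (simp add: card_Diff_subset)
    with Suc.IH[of "X - L"] Suc.prems(1) obtain f where
      f: "\<forall>i<m. f i \<subseteq> X - L \<and> card (f i) = k" "\<forall>i j. i < j \<longrightarrow> j < m \<longrightarrow> (\<forall>x\<in>f i. \<forall>y\<in>f j. x < y)"
      by auto
    show ?case
    proof (intro exI conjI allI impI ballI)
      fix i assume "i < Suc m"
      then show "case_nat L f i \<subseteq> X" "card (case_nat L f i) = k"
        using f(1) L by (auto split: nat.split)
    next
      fix i j x y assume *: "i < j" "j < Suc m" "x \<in> case_nat L f i" "y \<in> case_nat L f j"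
      then obtain j' where j': "j = Suc j'" "j' < m"
        by (cases j) auto
      show "x < y"
      proof (cases i)
        case 0
        then have "x \<in> L" "y \<in> f j'"
          using *(3,4) j'(1) by simp_all
        moreover have "f j' \<subseteq> X - L"
          using f(1) j'(2) by blast
        ultimately show ?thesis
          using L(3) by blast
      next
        case (Suc i')
        then have "x \<in> f i'" "y \<in> f j'" "i' < j'"
          using * j'(1) by simp_all
        then show ?thesis
          using f(2) j'(2) by blast
      qed
    qed
  qed simp
  then show ?thesis
    using that by blast
qed

text \<open>One triple is taken from each of \<open>m\<close> successive blocks of \<open>k\<close>
  elements. In the applications \<open>Q\<close> says that the triple violates a comb condition, and
  \<open>k\<close> exceeds the largest size of a comb.\<close>

lemma obtain_separated_triples:
  fixes X :: "nat set"
  assumes "finite X" "m * k \<le> card X"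
    and "\<And>Y. Y \<subseteq> X \<Longrightarrow> card Y = k \<Longrightarrow> \<exists>u\<in>Y. \<exists>v\<in>Y. \<exists>w\<in>Y. u < v \<and> v < w \<and> Q u v w"
  obtains u v w where "\<And>i. i < m \<Longrightarrow> {u i, v i, w i} \<subseteq> X \<and> u i < v i \<and> v i < w i \<and> Q (u i) (v i) (w i)"
    "\<And>i j. i < j \<Longrightarrow> j < m \<Longrightarrow> w i < u j"
proof -
  obtain f where f: "\<And>i. i < m \<Longrightarrow> f i \<subseteq> X \<and> card (f i) = k"
    "\<And>i j x y. i < j \<Longrightarrow> j < m \<Longrightarrow> x \<in> f i \<Longrightarrow> y \<in> f j \<Longrightarrow> x < y"
    using obtain_blocks[OF assms(1,2)] by metis
  have "\<forall>i\<in>{..<m}. \<exists>t. fst t \<in> f i \<and> fst (snd t) \<in> f i \<and> snd (snd t) \<in> f i \<and>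
      fst t < fst (snd t) \<and> fst (snd t) < snd (snd t) \<and> Q (fst t) (fst (snd t)) (snd (snd t))"
  proof
    fix i assume "i \<in> {..<m}"
    then obtain u v w where "u \<in> f i" "v \<in> f i" "w \<in> f i" "u < v" "v < w" "Q u v w"
      using f(1) assms(3)[of "f i"] by auto
    then show "\<exists>t. fst t \<in> f i \<and> fst (snd t) \<in> f i \<and> snd (snd t) \<in> f i \<and>
      fst t < fst (snd t) \<and> fst (snd t) < snd (snd t) \<and> Q (fst t) (fst (snd t)) (snd (snd t))"
      by (intro exI[of _ "(u, v, w)"]) simp
  qed
  from bchoice[OF this] obtain t where t: "\<forall>i\<in>{..<m}. fst (t i) \<in> f i \<and> fst (snd (t i)) \<in> f i \<and> snd (snd (t i)) \<in> f i \<and>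
      fst (t i) < fst (snd (t i)) \<and> fst (snd (t i)) < snd (snd (t i)) \<and>
      Q (fst (t i)) (fst (snd (t i))) (snd (snd (t i)))"
    by blast
  show ?thesis
  proof (rule that)
    show "{fst (t i), fst (snd (t i)), snd (snd (t i))} \<subseteq> X \<and> fst (t i) < fst (snd (t i)) \<and>
        fst (snd (t i)) < snd (snd (t i)) \<and> Q (fst (t i)) (fst (snd (t i))) (snd (snd (t i)))" if "i < m" for i
      using t f(1) that by blast
    show "snd (snd (t i)) < fst (t j)" if "i < j" "j < m" for i j
      using t f(2)[OF that] that by simp
  qed
qed

text \<open>Cutting at the \<open>N\<close>-th smallest element of \<open>X\<close> leaves at least
  \<open>N\<close> elements of \<open>X\<close> on either side, and one side of the cut contains at
  least half of \<open>Y\<close>.\<close>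

lemma median_split:
  fixes X Y :: "nat set"
  assumes "finite X" "finite Y" "2 * N \<le> card X" "2 * N \<le> card Y"
  obtains t where "N \<le> card {x \<in> X. x \<le> t}" "N \<le> card {y \<in> Y. t < y}"
    | t where "N \<le> card {y \<in> Y. y \<le> t}" "N \<le> card {x \<in> X. t < x}"
proof (cases "N = 0")
  case False
  obtain L where L: "L \<subseteq> X" "card L = N" "\<And>x y. x \<in> L \<Longrightarrow> y \<in> X - L \<Longrightarrow> x < y"
    using obtain_lower_subset[of X N] assms(1,3) by auto
  have fin: "finite L" "L \<noteq> {}"
    using L(2) False by (auto simp: card_gt_0_iff intro: ccontr)
  define t where "t = Max L"
  have "L \<subseteq> {x \<in> X. x \<le> t}" "X - L \<subseteq> {x \<in> X. t < x}"
    using L(1) L(3)[OF Max_in[OF fin]] Max_ge[OF fin(1)] by (auto simp: t_def)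
  then have "card L \<le> card {x \<in> X. x \<le> t}" "card (X - L) \<le> card {x \<in> X. t < x}"
    using assms(1) by (auto intro!: card_mono)
  moreover have "card (X - L) \<ge> N"
    using L(1,2) fin(1) assms(3) by (simp add: card_Diff_subset)
  moreover have "card Y = card {y \<in> Y. y \<le> t} + card {y \<in> Y. t < y}"
    using assms(2) by (subst card_Un_disjoint[symmetric]) (auto intro!: arg_cong[of _ _ card])
  ultimately show ?thesis
    using that[of t] L(2) assms(4) by linarith
qed (use that in simp)

section \<open>Levels and branchings of a vertex set\<close>

definition levels :: "nat set \<Rightarrow> nat set" where
  "levels X = {lev x y | x y. x \<in> X \<and> y \<in> X \<and> x < y}"

text \<open>Pairs with a common branching interleave, whereas different branchings of equal height
  lie in disjoint subtrees. Comparing only pairs that lie one after the other therefore says that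
  distinct branchings have distinct levels.\<close>

definition distinct_levels :: "nat set \<Rightarrow> bool" where
  "distinct_levels X \<longleftrightarrow> (\<forall>p\<in>X. \<forall>q\<in>X. \<forall>y\<in>X. \<forall>z\<in>X. p < q \<and> q < y \<and> y < z \<longrightarrow> lev p q \<noteq> lev y z)"

text \<open>The two halves below the topmost branching of the tree spanned by \<open>X\<close>,
  which has height \<open>a\<close>.\<close>

definition splits :: "nat set \<Rightarrow> nat set \<Rightarrow> nat set \<Rightarrow> nat \<Rightarrow> bool" where
  "splits X L R a \<longleftrightarrow> L \<noteq> {} \<and> R \<noteq> {} \<and> X = L \<union> R \<and>
     (\<forall>x\<in>L. \<forall>y\<in>R. x < y \<and> lev x y = a) \<and>
     (\<forall>x\<in>L. \<forall>y\<in>L. x < y \<longrightarrow> lev x y < a) \<and> (\<forall>x\<in>R. \<forall>y\<in>R. x < y \<longrightarrow> lev x y < a)"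

lemma splits_disjoint: "splits X L R a \<Longrightarrow> L \<inter> R = {}"
  unfolding splits_def by (metis disjoint_iff less_irrefl)

text \<open>The root level is the one between the minimum and the maximum, and the left half
  consists of the vertices whose level from the minimum is smaller. Inside the right half the root
  level cannot recur, by \<open>lev_neq\<close>.\<close>

lemma splits_exists:
  assumes "finite X" "2 \<le> card X"
  shows "\<exists>L R a. splits X L R a"
proof -
  define b c a where "b = Min X" and "c = Max X" and "a = lev b c"
  have ne: "X \<noteq> {}"
    using assms(2) by auto
  have bX: "b \<in> X" "\<And>x. x \<in> X \<Longrightarrow> b \<le> x" and cX: "c \<in> X" "\<And>x. x \<in> X \<Longrightarrow> x \<le> c"
    using assms(1) ne by (simp_all add: b_def c_def)
  have "b \<noteq> c"
  proof
    assume "b = c"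
    then have "X \<subseteq> {b}"
      using bX cX by (auto intro: antisym)
    then show False
      using card_mono[of "{b}" X] assms(2) by simp
  qed
  then have bc: "b < c"
    using bX cX by (simp add: le_neq_implies_less)
  define L R where "L = {x \<in> X. lev b x < a}" and "R = {x \<in> X. lev b x = a}"
  have le: "lev b x \<le> a" if "x \<in> X" for x
    using lev_mono[of b b x c] bX cX that by (simp add: a_def)
  have "b \<in> L" "c \<in> R"
    using bX cX lev_pos[OF bc] by (simp_all add: L_def R_def a_def lev_self)
  moreover have "X = L \<union> R"
    using le by (auto simp: L_def R_def le_neq_implies_less)
  moreover have "x < y \<and> lev x y = a" if "x \<in> L" "y \<in> R" for x y
  proof -
    have *: "x \<in> X" "y \<in> X" "lev b x < a" "lev b y = a"
      using that by (auto simp: L_def R_def)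
    then have "\<not> y \<le> x"
      using lev_mono[of b b y x] bX by auto
    then show ?thesis
      using lev_trans[of b x y] * bX by (auto simp: max_def split: if_splits)
  qed
  moreover have "lev x y < a" if "x \<in> L" "y \<in> L" "x < y" for x y
    using lev_mono[of b x y y] that bX by (auto simp: L_def intro: le_less_trans)
  moreover have "lev x y < a" if "x \<in> R" "y \<in> R" "x < y" for x y
  proof -
    have "x \<in> X" "y \<in> X" "lev b x = a" "b \<noteq> x"
      using that \<open>b \<in> L\<close> by (auto simp: R_def L_def)
    then show ?thesis
      using lev_neq[of b x y] lev_mono[of b x y c] bX cX that(3)
      by (metis a_def le_neq_implies_less order_less_imp_le)
  qed
  ultimately have "splits X L R a"
    unfolding splits_def by blast
  then show ?thesis
    by blast
qed

text \<open>Structural induction on the binary tree spanned by \<open>X\<close>, with single leaves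
  as base case.\<close>

lemma split_induct [consumes 2, case_names singleton split]:
  assumes "finite X" "X \<noteq> {}"
    and "\<And>x. P {x}"
    and "\<And>X L R a. finite L \<Longrightarrow> finite R \<Longrightarrow> splits X L R a \<Longrightarrow> P L \<Longrightarrow> P R \<Longrightarrow> P X"
  shows "P X"
  using assms(1,2)
proof (induction X rule: finite_psubset_induct)
  case (psubset X)
  show ?case
  proof (cases "2 \<le> card X")
    case True
    then obtain L R a where s: "splits X L R a"
      using splits_exists psubset.hyps by blast
    then have "X = L \<union> R" "L \<noteq> {}" "R \<noteq> {}" "L \<inter> R = {}"
      using splits_disjoint by (auto simp: splits_def)
    then have "L \<subset> X" "R \<subset> X" "L \<noteq> {}" "R \<noteq> {}" "finite L" "finite R"
      using psubset.hyps by auto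
    then show ?thesis
      using assms(4)[OF _ _ s] psubset.IH by simp
  next
    case False
    then have "card X = 1"
      using psubset.hyps psubset.prems card_gt_0_iff[of X] by linarith
    then show ?thesis
      using assms(3) by (auto simp: card_1_singleton_iff)
  qed
qed

lemma levelsI: "x \<in> X \<Longrightarrow> y \<in> X \<Longrightarrow> x < y \<Longrightarrow> lev x y \<in> levels X"
  unfolding levels_def by blast

lemma levels_mono: "X \<subseteq> Y \<Longrightarrow> levels X \<subseteq> levels Y"
  by (auto simp: levels_def)

lemma finite_levels: "finite X \<Longrightarrow> finite (levels X)"
  by (rule finite_subset[of _ "case_prod lev ` (X \<times> X)"]) (auto simp: levels_def)

lemma levels_splits:
  assumes "splits X L R a"
  shows "levels X = insert a (levels L \<union> levels R)"
proof
  have X: "X = L \<union> R" and LR: "\<And>x y. x \<in> L \<Longrightarrow> y \<in> R \<Longrightarrow> x < y \<and> lev x y = a"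
    using assms by (auto simp: splits_def)
  show "levels X \<subseteq> insert a (levels L \<union> levels R)"
  proof
    fix l assume "l \<in> levels X"
    then obtain x y where xy: "x \<in> L \<union> R" "y \<in> L \<union> R" "x < y" "l = lev x y"
      by (auto simp: levels_def X)
    then consider "x \<in> L" "y \<in> L" | "x \<in> R" "y \<in> R" | "x \<in> L" "y \<in> R"
      using LR[of y x] by force
    then show "l \<in> insert a (levels L \<union> levels R)"
      using xy(3,4) LR by cases (auto simp: levels_def)
  qed
  obtain x y where "x \<in> L" "y \<in> R"
    using assms by (auto simp: splits_def)
  then have "a \<in> levels X"
    using LR[of x y] unfolding levels_def X by blast
  then show "insert a (levels L \<union> levels R) \<subseteq> levels X"
    using levels_mono[of L X] levels_mono[of R X] by (auto simp: X)
qed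

lemma levels_splits_less: "splits X L R a \<Longrightarrow> l \<in> levels L \<union> levels R \<Longrightarrow> l < a"
  by (auto simp: levels_def splits_def)

text \<open>A binary tree has one branching fewer than leaves, and several branchings may share a
  level.\<close>

lemma card_levels_less: "finite X \<Longrightarrow> X \<noteq> {} \<Longrightarrow> card (levels X) < card X"
proof (induction rule: split_induct)
  case (singleton x)
  then show ?case
    by (simp add: levels_def)
next
  case (split X L R a)
  have "card (levels X) \<le> 1 + card (levels L) + card (levels R)"
    unfolding levels_splits[OF split(3)]
    using card_Un_le[of "levels L" "levels R"] card_insert_le_m1[of "Suc (card (levels L \<union> levels R))"]
    by (simp add: card_insert_if split(1,2) finite_levels)
  moreover have "card X = card L + card R"
    using split(1-3) splits_disjoint[OF split(3)] by (simp add: splits_def card_Un_disjoint)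
  ultimately show ?case
    using split(4,5) by linarith
qed

lemma distinct_levels_subset: "distinct_levels Y \<Longrightarrow> X \<subseteq> Y \<Longrightarrow> distinct_levels X"
  unfolding distinct_levels_def by blast

text \<open>Now no two branchings share a level: one common to both halves would occur for a pair in
  \<open>L\<close> and again for a later pair in \<open>R\<close>.\<close>

lemma card_le_levels:
  assumes "finite X" "X \<noteq> {}" "distinct_levels X"
  shows "card X \<le> Suc (card (levels X))"
  using assms
proof (induction rule: split_induct)
  case (singleton x)
  then show ?case
    by simp
next
  case (split X L R a)
  have X: "L \<subseteq> X" "R \<subseteq> X"
    using split(3) by (auto simp: splits_def)
  have "a \<notin> levels L \<union> levels R"
    using levels_splits_less[OF split(3)] by blast
  moreover have "levels L \<inter> levels R = {}"
  proof -
    have "lev p q \<noteq> lev y z" if "p \<in> L" "q \<in> L" "y \<in> R" "z \<in> R" "p < q" "y < z" for p q y z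
    proof -
      have "q < y"
        using split(3) that(2,3) by (simp add: splits_def)
      then show ?thesis
        using split.prems that X unfolding distinct_levels_def by (meson subsetD)
    qed
    then show ?thesis
      unfolding levels_def by blast
  qed
  ultimately have "card (levels X) = 1 + card (levels L) + card (levels R)"
    unfolding levels_splits[OF split(3)]
    by (simp add: card_Un_disjoint split(1,2) finite_levels)
  moreover have "card X = card L + card R"
    using split(1-3) splits_disjoint[OF split(3)] by (simp add: splits_def card_Un_disjoint)
  ultimately show ?case
    using split(4,5) distinct_levels_subset[OF split.prems] X by fastforce
qed

text \<open>The vertices fall into clusters with mutual levels at most \<open>t\<close>, and
  \<open>Y\<close> keeps the least vertex of each. Passing to representatives does not change a
  level above \<open>t\<close>.\<close>

lemma obtain_upper_representatives:
  assumes "finite X"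
  obtains Y where "Y \<subseteq> X" "\<And>x y. x \<in> Y \<Longrightarrow> y \<in> Y \<Longrightarrow> x < y \<Longrightarrow> t < lev x y"
    "{l \<in> levels X. t < l} \<subseteq> levels Y"
proof -
  define Y where "Y = {x \<in> X. \<forall>w\<in>X. w < x \<longrightarrow> t < lev w x}"
  have rep: "\<exists>r\<in>Y. r \<le> x \<and> lev r x \<le> t" if "x \<in> X" for x
  proof -
    define r where "r = Min {w \<in> X. w \<le> x \<and> lev w x \<le> t}"
    have fin: "finite {w \<in> X. w \<le> x \<and> lev w x \<le> t}" and ne: "{w \<in> X. w \<le> x \<and> lev w x \<le> t} \<noteq> {}"
      using assms that lev_self[of x] by auto
    have r: "r \<in> X" "r \<le> x" "lev r x \<le> t" and min: "\<And>w. w \<in> X \<Longrightarrow> w \<le> x \<Longrightarrow> lev w x \<le> t \<Longrightarrow> r \<le> w"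
      using Min_in[OF fin ne] Min_le[OF fin] unfolding r_def by auto
    have "t < lev w r" if "w \<in> X" "w < r" for w
      using lev_trans[of w r x] min[of w] r that by (force simp: not_le[symmetric])
    then show ?thesis
      using r by (auto simp: Y_def)
  qed
  show ?thesis
  proof (rule that)
    show "Y \<subseteq> X"
      by (auto simp: Y_def)
    show "t < lev x y" if "x \<in> Y" "y \<in> Y" "x < y" for x y
      using that by (auto simp: Y_def)
    show "{l \<in> levels X. t < l} \<subseteq> levels Y"
    proof
      fix l assume "l \<in> {l \<in> levels X. t < l}"
      then obtain x y where xy: "x \<in> X" "y \<in> X" "x < y" "l = lev x y" "t < lev x y"
        by (auto simp: levels_def)
      obtain r s where r: "r \<in> Y" "r \<le> x" "lev r x \<le> t" and s: "s \<in> Y" "s \<le> y" "lev s y \<le> t"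
        using rep xy by meson
      \<comment> \<open>Otherwise \<open>x\<close> would lie between \<open>s\<close> and
        \<open>y\<close> and hence in the cluster of \<open>y\<close>.\<close>
      have "x < s"
      proof (rule ccontr)
        assume "\<not> x < s"
        then have "lev x y \<le> lev s y"
          using lev_mono[of s x y y] xy by simp
        then show False
          using s xy by simp
      qed
      then have "lev r s = l"
        using lev_trans[of x s y] lev_trans[of r x s] r s xy by (auto simp: max_def split: if_splits)
      moreover have "r < s"
        using \<open>x < s\<close> r(2) by simp
      ultimately show "l \<in> levels Y"
        using r(1) s(1) unfolding levels_def by blast
    qed
  qed
qed

subsection \<open>Independent sets\<close>

text \<open>Reduces to exactly \<open>m\<close> levels and \<open>m\<close> pairs by discarding the
  surplus; disjointness makes the indexing of the pairs injective.\<close>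

lemma mixing_indexed:
  assumes "mixing U m \<phi>" "B \<subseteq> U" "m \<le> card B" "m \<le> card I"
    and "x ` I \<subseteq> U" "y ` I \<subseteq> U" "\<And>i. i \<in> I \<Longrightarrow> x i \<noteq> y i"
    and "\<And>i j. i \<in> I \<Longrightarrow> j \<in> I \<Longrightarrow> i \<noteq> j \<Longrightarrow> {x i, y i} \<inter> {x j, y j} = {}"
  shows "\<exists>b\<in>B. \<exists>i\<in>I. x i \<in> \<phi> b \<and> y i \<notin> \<phi> b"
proof -
  obtain B' where B': "B' \<subseteq> B" "card B' = m"
    using assms(3) by (meson obtain_subset_with_card_n)
  obtain J where J: "J \<subseteq> I" "card J = m"
    using assms(4) by (meson obtain_subset_with_card_n)
  define P where "P = (\<lambda>i. (x i, y i)) ` J"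
  have "inj_on (\<lambda>i. (x i, y i)) J"
  proof (rule inj_onI)
    fix i j assume "i \<in> J" "j \<in> J" "(x i, y i) = (x j, y j)"
    then show "i = j"
      using assms(8)[of i j] J(1) by auto
  qed
  then have "card P = m"
    using J(2) by (simp add: P_def card_image)
  moreover have "P \<subseteq> U \<times> U"
    using assms(5,6) J(1) by (auto simp: P_def image_subset_iff)
  moreover have "disjoint_pairs P"
    unfolding disjoint_pairs_def
  proof (intro conjI ballI impI)
    fix p assume "p \<in> P"
    then show "fst p \<noteq> snd p"
      using assms(7) J(1) by (auto simp: P_def)
  next
    fix p q assume "p \<in> P" "q \<in> P" "p \<noteq> q"
    then obtain i j where "i \<in> I" "j \<in> I" "p = (x i, y i)" "q = (x j, y j)" "i \<noteq> j"
      using J(1) by (auto simp: P_def)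
    then show "{fst p, snd p} \<inter> {fst q, snd q} = {}"
      using assms(8)[of i j] by simp
  qed
  moreover have "B' \<subseteq> U"
    using B'(1) assms(2) by blast
  ultimately have "\<exists>b\<in>B'. \<exists>(x, y)\<in>P. x \<in> \<phi> b \<and> y \<notin> \<phi> b"
    using assms(1) B'(2) unfolding mixing_def by blast
  then show ?thesis
    using B'(1) J(1) by (auto simp: P_def)
qed

text \<open>The lowest \<open>4 * m\<close> levels form \<open>2 * m\<close> consecutive pairs,
  followed by \<open>m\<close> levels \<open>B\<close> and at least \<open>m\<close> levels
  \<open>A\<close>. Mixing lets fewer than \<open>m\<close> pairs fail for \<open>A\<close>, and
  fewer than \<open>m\<close> fail for \<open>B\<close> with swapped components, so some pair serves
  both.\<close>

lemma descent_exists: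
  assumes "mixing U m \<phi>" "finite S" "S \<subseteq> U" "6 * m \<le> card S"
  shows "\<exists>a\<in>S. \<exists>b\<in>S. \<exists>c\<in>S. \<exists>d\<in>S. descent \<phi> a b c d"
proof -
  obtain L where L: "L \<subseteq> S" "card L = 4 * m" "\<And>x y. x \<in> L \<Longrightarrow> y \<in> S - L \<Longrightarrow> x < y"
    using obtain_lower_subset[OF assms(2), of "4 * m"] assms(4) by auto
  have fin: "finite L" "finite (S - L)"
    using L(1) assms(2) finite_subset by auto
  have SL: "2 * m \<le> card (S - L)"
    using L(1,2) fin assms(4) by (simp add: card_Diff_subset)
  obtain B where B: "B \<subseteq> S - L" "card B = m" "\<And>x y. x \<in> B \<Longrightarrow> y \<in> S - L - B \<Longrightarrow> x < y"
    using obtain_lower_subset[OF fin(2), of m] SL by auto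
  define A where "A = S - L - B"
  have A: "m \<le> card A"
    using SL B(1,2) fin(2) finite_subset[OF B(1)] by (simp add: A_def card_Diff_subset)
  have "(2 * m) * 2 \<le> card L"
    using L(2) by simp
  from obtain_blocks[OF fin(1) this] obtain f where
    f: "\<And>i. i < 2 * m \<Longrightarrow> f i \<subseteq> L \<and> card (f i) = 2"
      "\<And>i j x y. i < j \<Longrightarrow> j < 2 * m \<Longrightarrow> x \<in> f i \<Longrightarrow> y \<in> f j \<Longrightarrow> x < y"
    by blast
  define c d where "c = (\<lambda>i. Max (f i))" and "d = (\<lambda>i. Min (f i))"
  have cd: "c i \<in> f i" "d i \<in> f i" "d i < c i" if "i < 2 * m" for i
  proof -
    have "card (f i) = 2"
      using f(1) that by blast
    then obtain x y where "f i = {x, y}" "x \<noteq> y"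
      by (auto simp: card_2_iff)
    then show "c i \<in> f i" "d i \<in> f i" "d i < c i"
      by (auto simp: c_def d_def min_def max_def)
  qed
  have cdL: "c i \<in> L" "d i \<in> L" if "i < 2 * m" for i
    using cd[OF that] f(1)[OF that] by auto
  have cd_dis: "{c i, d i} \<inter> {c j, d j} = {}" if "i < 2 * m" "j < 2 * m" "i \<noteq> j" for i j
  proof -
    have "f i \<inter> f j = {}"
    proof (rule ccontr)
      assume "f i \<inter> f j \<noteq> {}"
      then obtain x where "x \<in> f i" "x \<in> f j"
        by blast
      then show False
        using f(2)[of i j x x] f(2)[of j i x x] that by linarith
    qed
    moreover have "{c i, d i} \<subseteq> f i" "{c j, d j} \<subseteq> f j"
      using cd(1,2) that by simp_all
    ultimately show ?thesis
      by blast
  qed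
  have cdU: "c i \<in> U" "d i \<in> U" if "i < 2 * m" for i
    using cdL[OF that] L(1) assms(3) by auto
  have ABU: "A \<subseteq> U" "B \<subseteq> U"
    using B(1) assms(3) by (auto simp: A_def)
  define I where "I = {i \<in> {..<2 * m}. \<forall>a\<in>A. \<not> (c i \<in> \<phi> a \<and> d i \<notin> \<phi> a)}"
  define J where "J = {i \<in> {..<2 * m}. \<forall>b\<in>B. \<not> (d i \<in> \<phi> b \<and> c i \<notin> \<phi> b)}"
  have "card I < m"
  proof (rule ccontr)
    assume "\<not> card I < m"
    then have "\<exists>a\<in>A. \<exists>i\<in>I. c i \<in> \<phi> a \<and> d i \<notin> \<phi> a"
      using cdU cd(3) cd_dis A ABU(1)
      by (intro mixing_indexed[OF assms(1)]) (simp_all add: I_def image_subset_iff less_imp_neq[symmetric])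
    then show False
      by (auto simp: I_def)
  qed
  moreover have "card J < m"
  proof (rule ccontr)
    assume "\<not> card J < m"
    then have "\<exists>b\<in>B. \<exists>i\<in>J. d i \<in> \<phi> b \<and> c i \<notin> \<phi> b"
      using cdU cd(3) cd_dis B(2) ABU(2)
      by (intro mixing_indexed[OF assms(1)]) (simp_all add: J_def image_subset_iff less_imp_neq insert_commute)
    then show False
      by (auto simp: J_def)
  qed
  ultimately have "card (I \<union> J) < card {..<2 * m}"
    using card_Un_le[of I J] by simp
  then have "\<not> {..<2 * m} \<subseteq> I \<union> J"
    using card_mono[of "I \<union> J" "{..<2 * m}"] by (force simp: I_def J_def)
  then obtain i where i: "i < 2 * m" "i \<notin> I" "i \<notin> J"
    by auto
  then obtain a b where ab: "a \<in> A" "c i \<in> \<phi> a" "d i \<notin> \<phi> a" "b \<in> B" "d i \<in> \<phi> b" "c i \<notin> \<phi> b"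
    by (auto simp: I_def J_def)
  then have "descent \<phi> a b (c i) (d i)"
    using B(1,3) L(3)[OF cdL(1)[OF i(1)], of b] cd(3)[OF i(1)] unfolding descent_def A_def by blast
  moreover have "a \<in> S" "b \<in> S" "c i \<in> S" "d i \<in> S"
    using ab B(1) cdL[OF i(1)] L(1) by (auto simp: A_def)
  ultimately show ?thesis
    by blast
qed

text \<open>The combs are named after the side on which their spine descends.\<close>

definition right_comb :: "nat set \<Rightarrow> bool" where
  "right_comb C \<longleftrightarrow> (\<forall>u\<in>C. \<forall>v\<in>C. \<forall>w\<in>C. u < v \<and> v < w \<longrightarrow> lev u v > lev v w)"

definition left_comb :: "nat set \<Rightarrow> bool" where
  "left_comb C \<longleftrightarrow> (\<forall>u\<in>C. \<forall>v\<in>C. \<forall>w\<in>C. u < v \<and> v < w \<longrightarrow> lev u v < lev v w)"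

definition red_free :: "(nat \<Rightarrow> nat set) \<Rightarrow> nat set \<Rightarrow> bool" where
  "red_free \<phi> A \<longleftrightarrow> (\<forall>e. e \<subseteq> A \<longrightarrow> \<not> red_set \<phi> e)"

lemma red_freeD:
  assumes "red_free \<phi> A" "{p, q, r, s, t} \<subseteq> A" "p < q" "q < r" "r < s" "s < t"
  shows "\<not> red_levels \<phi> (lev p q) (lev q r) (lev r s) (lev s t)"
  using assms(1,2) unfolding red_free_def red_set_iff[OF assms(3-6), symmetric] by simp

lemma red_free_subset: "red_free \<phi> A \<Longrightarrow> B \<subseteq> A \<Longrightarrow> red_free \<phi> B"
  unfolding red_free_def by blast

text \<open>With \<open>t\<close> the last vertex, the level of a pair depends only on its left
  element and determines it. A descent among the levels to \<open>t\<close> is thus realised by four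
  vertices followed by \<open>t\<close>, which form a red set.\<close>

lemma card_right_comb_le:
  assumes mix: "mixing U m \<phi>" and free: "red_free \<phi> C" and C: "finite C" "right_comb C" "levels C \<subseteq> U"
  shows "card C \<le> 6 * m"
proof (rule ccontr)
  assume big: "\<not> card C \<le> 6 * m"
  then have ne: "C \<noteq> {}"
    by auto
  define t where "t = Max C"
  have t: "t \<in> C" "\<And>x. x \<in> C - {t} \<Longrightarrow> x < t"
    using C(1) ne Max_ge[OF C(1)] by (auto simp: t_def le_neq_implies_less)
  define l where "l = (\<lambda>x. lev x t)"
  have dec: "lev x y = l x" "l y < l x" if "x \<in> C" "y \<in> C - {t}" "x < y" for x y
  proof -
    have "lev y t < lev x y"
      using C(2) t that unfolding right_comb_def by blast
    then show "lev x y = l x" "l y < l x"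
      using lev_trans[of x y t] t(2)[OF that(2)] that(3) by (auto simp: l_def)
  qed
  have "inj_on l (C - {t})"
    by (rule inj_onI) (metis DiffD1 dec(2) less_irrefl nat_neq_iff)
  then have "6 * m \<le> card (l ` (C - {t}))"
    using big t(1) C(1) by (simp add: card_image)
  moreover have "l ` (C - {t}) \<subseteq> U"
    using C(3) t unfolding levels_def l_def by blast
  ultimately obtain p q r s where v: "p \<in> C - {t}" "q \<in> C - {t}" "r \<in> C - {t}" "s \<in> C - {t}"
    and des: "descent \<phi> (l p) (l q) (l r) (l s)"
    using descent_exists[OF mix, of "l ` (C - {t})"] C(1) by auto
  have lt: "x < y" if "x \<in> C - {t}" "y \<in> C - {t}" "l y < l x" for x y
    using dec(2)[of y x] that by (metis DiffD1 less_asym less_irrefl nat_neq_iff)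
  have "p < q" "q < r" "r < s" "s < t"
    using lt v des t(2) unfolding descent_def by blast+
  moreover have "red_levels \<phi> (lev p q) (lev q r) (lev r s) (lev s t)"
    using dec(1) v des calculation unfolding red_levels_def by (simp add: l_def)
  ultimately show False
    using red_freeD[OF free, of p q r s t] v t(1) by blast
qed

text \<open>Mirror image of \<open>card_right_comb_le\<close>: levels are measured from the first
  vertex, and the reversed \<open>descent\<close> in \<open>red_levels\<close> applies.\<close>

lemma card_left_comb_le:
  assumes mix: "mixing U m \<phi>" and free: "red_free \<phi> C" and C: "finite C" "left_comb C" "levels C \<subseteq> U"
  shows "card C \<le> 6 * m"
proof (rule ccontr)
  assume big: "\<not> card C \<le> 6 * m"
  then have ne: "C \<noteq> {}"
    by auto
  define t where "t = Min C"
  have t: "t \<in> C" "\<And>x. x \<in> C - {t} \<Longrightarrow> t < x"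
    using C(1) ne Min_le[OF C(1)] by (auto simp: t_def le_neq_implies_less)
  define l where "l = (\<lambda>x. lev t x)"
  have inc: "lev x y = l y" "l x < l y" if "x \<in> C - {t}" "y \<in> C" "x < y" for x y
  proof -
    have "lev t x < lev x y"
      using C(2) t that unfolding left_comb_def by blast
    then show "lev x y = l y" "l x < l y"
      using lev_trans[of t x y] t(2)[OF that(1)] that(3) by (auto simp: l_def)
  qed
  have "inj_on l (C - {t})"
    by (rule inj_onI) (metis DiffD1 inc(2) less_irrefl nat_neq_iff)
  then have "6 * m \<le> card (l ` (C - {t}))"
    using big t(1) C(1) by (simp add: card_image)
  moreover have "l ` (C - {t}) \<subseteq> U"
    using C(3) t unfolding levels_def l_def by blast
  ultimately obtain p q r s where v: "p \<in> C - {t}" "q \<in> C - {t}" "r \<in> C - {t}" "s \<in> C - {t}"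
    and des: "descent \<phi> (l s) (l r) (l q) (l p)"
    using descent_exists[OF mix, of "l ` (C - {t})"] C(1) by auto
  have lt: "x < y" if "x \<in> C - {t}" "y \<in> C - {t}" "l x < l y" for x y
    using inc(2)[of y x] that by (metis DiffD1 less_asym less_irrefl nat_neq_iff)
  have "t < p" "p < q" "q < r" "r < s"
    using lt v des t(2) unfolding descent_def by blast+
  moreover have "red_levels \<phi> (lev t p) (lev p q) (lev q r) (lev r s)"
    using inc(1) v des calculation unfolding red_levels_def by (simp add: l_def)
  ultimately show False
    using red_freeD[OF free, of t p q r s] v t(1) by blast
qed

lemma not_right_comb_triple:
  assumes "\<not> right_comb Y"
  shows "\<exists>u\<in>Y. \<exists>v\<in>Y. \<exists>w\<in>Y. u < v \<and> v < w \<and> lev u v < lev v w"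
  using assms lev_neq unfolding right_comb_def by (metis linorder_neqE_nat)

lemma not_left_comb_triple:
  assumes "\<not> left_comb Y"
  shows "\<exists>u\<in>Y. \<exists>v\<in>Y. \<exists>w\<in>Y. u < v \<and> v < w \<and> lev v w < lev u v"
  using assms lev_neq unfolding left_comb_def by (metis linorder_neqE_nat)

text \<open>
  From each block of \<open>6 * m + 1\<close> consecutive vertices we keep the middle vertex \<open>v\<close> of a triple with
  \<open>lev u v < lev v w\<close>. Two equal levels among the kept vertices then give a red set of the third kind.
\<close>

lemma distinct_levels_subset_exists:
  assumes mix: "mixing U m \<phi>" and free: "red_free \<phi> A" and A: "finite A" "levels A \<subseteq> U"
    and s: "s * (6 * m + 1) \<le> card A"
  shows "\<exists>A'\<subseteq>A. card A' = s \<and> distinct_levels A'"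
proof -
  have triple: "\<exists>u\<in>Y. \<exists>v\<in>Y. \<exists>w\<in>Y. u < v \<and> v < w \<and> lev u v < lev v w"
    if "Y \<subseteq> A" "card Y = 6 * m + 1" for Y
  proof (rule not_right_comb_triple, rule notI)
    assume "right_comb Y"
    then have "card Y \<le> 6 * m"
      using card_right_comb_le[OF mix red_free_subset[OF free that(1)]] that(1) A
        finite_subset levels_mono by (meson order.trans)
    then show False
      using that(2) by simp
  qed
  from obtain_separated_triples[OF A(1) s, of "\<lambda>u v w. lev u v < lev v w", OF triple]
  obtain u v w where uvw: "\<And>i. i < s \<Longrightarrow> {u i, v i, w i} \<subseteq> A \<and> u i < v i \<and> v i < w i \<and> lev (u i) (v i) < lev (v i) (w i)"
    and sep: "\<And>i j. i < j \<Longrightarrow> j < s \<Longrightarrow> w i < u j"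
    by blast
  have uv: "u i < v i" "v i < w i" "u i \<in> A" "v i \<in> A" "lev (u i) (v i) < lev (v i) (w i)" if "i < s" for i
    using uvw[OF that] by simp_all
  have v_mono: "v i < v j" if "i < j" "j < s" for i j
    using uv(1)[OF that(2)] uv(2)[of i] sep[OF that] that by linarith
  have v_less: "i < j" if "v i < v j" "i < s" "j < s" for i j
    using that v_mono[of j i] by (cases i j rule: linorder_cases) auto
  have "card (v ` {..<s}) = s"
  proof -
    have "inj_on v {..<s}"
      by (rule inj_onI) (metis lessThan_iff less_irrefl linorder_neqE_nat v_mono)
    then show ?thesis
      by (simp add: card_image)
  qed
  moreover have "v ` {..<s} \<subseteq> A"
    using uv by auto
  moreover have "lev p q \<noteq> lev y z"
    if pqyz: "p \<in> v ` {..<s}" "q \<in> v ` {..<s}" "y \<in> v ` {..<s}" "z \<in> v ` {..<s}" "p < q" "q < y" "y < z" for p q y z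
  proof
    assume eq: "lev p q = lev y z"
    obtain h where h: "h < s" "q = v h"
      using pqyz(2) by auto
    obtain i where i: "i < s" "y = v i"
      using pqyz(3) by auto
    obtain j where j: "j < s" "z = v j"
      using pqyz(4) by auto
    have A': "p \<in> A" "q \<in> A" "y \<in> A" "z \<in> A" "u i \<in> A"
      using pqyz(1) h i j uv by auto
    have "w h < u i"
      using sep[of h i] v_less[of h i] pqyz(6) h i by simp
    then have "q < u i" "u i < y"
      using uv[OF h(1)] uv[OF i(1)] h i by simp_all
    \<comment> \<open>As \<open>w i\<close> lies between \<open>y = v i\<close> and
      \<open>z\<close>, the level of \<open>y\<close> and \<open>z\<close> is at least that of
      \<open>v i\<close> and \<open>w i\<close>, which beats the level of \<open>u i\<close> and
      \<open>v i\<close>.\<close>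
    have "w i < z"
      using sep[of i j] v_less[of i j] pqyz(7) i j uv(1)[OF j(1)] by simp
    then have d: "lev (u i) y < lev y z"
      using uv(5)[OF i(1)] lev_mono[of y y "w i" z] uv(2)[OF i(1)] i(2) by simp
    \<comment> \<open>Equal outer levels force a larger middle one: otherwise
      \<open>lev p y = lev p q = lev y z\<close>, contrary to \<open>lev_neq\<close>.\<close>
    have a: "lev y z < lev q y"
      using lev_trans[of p q y] lev_neq[of p y z] pqyz(5-7) eq by (auto simp: max_def split: if_splits)
    have "lev q (u i) = lev q y"
      using lev_trans[of q "u i" y] \<open>q < u i\<close> \<open>u i < y\<close> d a by (auto simp: max_def split: if_splits)
    then have "red_levels \<phi> (lev p q) (lev q (u i)) (lev (u i) y) (lev y z)"
      using eq a d unfolding red_levels_def by simp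
    then show False
      using red_freeD[OF free, of p q "u i" y z] A' \<open>q < u i\<close> \<open>u i < y\<close> pqyz(5,7) by simp
  qed
  ultimately show ?thesis
    unfolding distinct_levels_def by blast
qed

text \<open>
  Walking down the tree into the larger half, each step that discards fewer than \<open>k\<close> vertices
  extends one of the two combs.
\<close>

lemma balanced_split_or_combs:
  assumes "finite X" "X \<noteq> {}" "0 < k"
  shows "(\<exists>Y L R a. Y \<subseteq> X \<and> splits Y L R a \<and> k \<le> card L \<and> k \<le> card R) \<or>
    (\<exists>C D. C \<subseteq> X \<and> D \<subseteq> X \<and> right_comb C \<and> left_comb D \<and> card X \<le> (card C + card D) * k)"
  using assms(1,2)
proof (induction rule: split_induct)
  case (singleton x)
  have "right_comb {x}" "left_comb {x}"
    by (auto simp: right_comb_def left_comb_def)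
  moreover have "card {x} \<le> (card {x} + card {x}) * k"
    using assms(3) by simp
  ultimately show ?case
    by blast
next
  case (split X L R a)
  have X: "X = L \<union> R" "L \<noteq> {}" "R \<noteq> {}" and lr: "\<And>x y. x \<in> L \<Longrightarrow> y \<in> R \<Longrightarrow> x < y \<and> lev x y = a"
    and ll: "\<And>x y. x \<in> L \<Longrightarrow> y \<in> L \<Longrightarrow> x < y \<Longrightarrow> lev x y < a"
    and rr: "\<And>x y. x \<in> R \<Longrightarrow> y \<in> R \<Longrightarrow> x < y \<Longrightarrow> lev x y < a"
    using split(3) by (auto simp: splits_def)
  have card: "card X = card L + card R"
    using splits_disjoint[OF split(3)] X split(1,2) by (simp add: card_Un_disjoint)
  show ?case
  proof (cases "\<exists>Y L R a. Y \<subseteq> X \<and> splits Y L R a \<and> k \<le> card L \<and> k \<le> card R")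
    case none: False
    consider "card L < k" | "card R < k"
      using none split(3) not_le by blast
    then show ?thesis
    proof cases
      case 1
      have "\<not> (\<exists>Y L' R' a. Y \<subseteq> R \<and> splits Y L' R' a \<and> k \<le> card L' \<and> k \<le> card R')"
        using none X(1) by blast
      with split(5) obtain C D where CD: "C \<subseteq> R" "D \<subseteq> R" "right_comb C" "left_comb D"
        "card R \<le> (card C + card D) * k"
        by blast
      obtain x where x: "x \<in> L"
        using X(2) by blast
      \<comment> \<open>From \<open>x\<close> all vertices of \<open>C\<close> have level
        \<open>a\<close>, which exceeds every level inside \<open>R\<close>, so \<open>x\<close> can
        be put in front.\<close>
      have "right_comb (insert x C)"
        unfolding right_comb_def
      proof (intro ballI impI)
        fix u v w assume *: "u \<in> insert x C" "v \<in> insert x C" "w \<in> insert x C" "u < v \<and> v < w"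
        have xC: "x < y" "lev x y = a" if "y \<in> C" for y
          using lr[OF x] CD(1) that by auto
        have vw: "v \<in> C" "w \<in> C"
          using * xC by (auto dest: order.asym)
        show "lev v w < lev u v"
        proof (cases "u = x")
          case True
          then show ?thesis
            using xC(2)[OF vw(1)] rr[of v w] vw * subsetD[OF CD(1)] by simp
        next
          case False
          then show ?thesis
            using CD(3) vw * unfolding right_comb_def by blast
        qed
      qed
      moreover have "card (insert x C) = Suc (card C)"
        using x CD(1) lr finite_subset[OF CD(1)] split(2) by (subst card_insert_disjoint) auto
      then have "card X \<le> (card (insert x C) + card D) * k"
        using card 1 CD(5) by simp
      moreover have "insert x C \<subseteq> X" "D \<subseteq> X"
        using x CD X(1) by auto
      ultimately show ?thesis
        using CD(4) by blast
    next
      case 2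
      have "\<not> (\<exists>Y L' R' a. Y \<subseteq> L \<and> splits Y L' R' a \<and> k \<le> card L' \<and> k \<le> card R')"
        using none X(1) by blast
      with split(4) obtain C D where CD: "C \<subseteq> L" "D \<subseteq> L" "right_comb C" "left_comb D"
        "card L \<le> (card C + card D) * k"
        by blast
      obtain x where x: "x \<in> R"
        using X(3) by blast
      have "left_comb (insert x D)"
        unfolding left_comb_def
      proof (intro ballI impI)
        fix u v w assume *: "u \<in> insert x D" "v \<in> insert x D" "w \<in> insert x D" "u < v \<and> v < w"
        have xD: "y < x" "lev y x = a" if "y \<in> D" for y
          using lr[OF _ x] CD(2) that by auto
        have uv: "u \<in> D" "v \<in> D"
          using * xD by (auto dest: order.asym)
        show "lev u v < lev v w"
        proof (cases "w = x")
          case True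
          then show ?thesis
            using xD(2)[OF uv(2)] ll[of u v] uv * subsetD[OF CD(2)] by simp
        next
          case False
          then show ?thesis
            using CD(4) uv * unfolding left_comb_def by blast
        qed
      qed
      moreover have "card (insert x D) = Suc (card D)"
        using x CD(2) lr finite_subset[OF CD(2)] split(1) by (subst card_insert_disjoint) auto
      then have "card X \<le> (card C + card (insert x D)) * k"
        using card 2 CD(5) by simp
      moreover have "C \<subseteq> X" "insert x D \<subseteq> X"
        using x CD X(1) by auto
      ultimately show ?thesis
        using CD(3) by blast
    qed
  qed simp
qed

text \<open>
  The levels of one side can be taken below those of the other. The upper levels contain \<open>m\<close> disjoint
  pairs (parent, child), so the mixing property yields a red set together with a lower level.
\<close>

lemma no_balanced_split:
  assumes mix: "mixing U m \<phi>" and free: "red_free \<phi> A" and A: "finite A" "levels A \<subseteq> U" "distinct_levels A"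
    and split: "splits X L R a" "X \<subseteq> A"
    and big: "2 * (m * (6 * m + 1)) < card L" "2 * (m * (6 * m + 1)) < card R"
  shows False
proof -
  \<comment> \<open>Room for \<open>m\<close> blocks of \<open>6 * m + 1\<close> vertices, each too
    large to be a comb. The factor 2 in the hypotheses pays for the median cut of the
    levels.\<close>
  define N where "N = m * (6 * m + 1)"
  have mN: "m \<le> N"
    by (simp add: N_def)
  have LR: "L \<subseteq> A" "R \<subseteq> A" "L \<noteq> {}" "R \<noteq> {}" and lr: "\<And>x y. x \<in> L \<Longrightarrow> y \<in> R \<Longrightarrow> x < y \<and> lev x y = a"
    and ll: "\<And>x y. x \<in> L \<Longrightarrow> y \<in> L \<Longrightarrow> x < y \<Longrightarrow> lev x y < a"
    and rr: "\<And>x y. x \<in> R \<Longrightarrow> y \<in> R \<Longrightarrow> x < y \<Longrightarrow> lev x y < a"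
    using split by (auto simp: splits_def)
  have fin: "finite L" "finite R"
    using LR A(1) finite_subset by auto
  have lev: "2 * N \<le> card (levels L)" "2 * N \<le> card (levels R)"
    using card_le_levels[OF fin(1) LR(3) distinct_levels_subset[OF A(3) LR(1)]]
      card_le_levels[OF fin(2) LR(4) distinct_levels_subset[OF A(3) LR(2)]] big by (simp_all add: N_def)
  have lowerU: "{l \<in> levels Z. l \<le> t} \<subseteq> U" if "Z \<subseteq> A" for Z t
    using levels_mono[OF that] A(2) by blast
  have upper: "\<exists>Y\<subseteq>Z. N \<le> card Y \<and> (\<forall>x\<in>Y. \<forall>y\<in>Y. x < y \<longrightarrow> t < lev x y)"
    if Z: "Z \<subseteq> A" "N \<le> card {l \<in> levels Z. t < l}" for Z t
  proof -
    have finZ: "finite Z"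
      using Z(1) A(1) finite_subset by blast
    obtain Y where Y: "Y \<subseteq> Z" "\<And>x y. x \<in> Y \<Longrightarrow> y \<in> Y \<Longrightarrow> x < y \<Longrightarrow> t < lev x y"
      "{l \<in> levels Z. t < l} \<subseteq> levels Y"
      using obtain_upper_representatives[OF finZ, of t] by blast
    have finY: "finite Y"
      using Y(1) finZ finite_subset by blast
    have "N \<le> card (levels Y)"
      using Z(2) card_mono[OF finite_levels[OF finY] Y(3)] by simp
    also have "\<dots> \<le> card Y"
      using card_levels_less[OF finY] by (cases "Y = {}") (auto simp: levels_def)
    finally show ?thesis
      using Y(1,2) by blast
  qed
  \<comment> \<open>Different triples occupy disjoint intervals of vertices, so
    \<open>distinct_levels\<close> separates their pairs of levels.\<close>
  have dis: "{lev (u i) (v i), lev (v i) (w i)} \<inter> {lev (u j) (v j), lev (v j) (w j)} = {}"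
    if tr: "\<And>i. i < m \<Longrightarrow> {u i, v i, w i} \<subseteq> A \<and> u i < v i \<and> v i < w i"
      "\<And>i j. i < j \<Longrightarrow> j < m \<Longrightarrow> w i < u j" "i < m" "j < m" "i \<noteq> j" for u v w :: "nat \<Rightarrow> nat" and i j
  proof -
    have *: "{lev (u i) (v i), lev (v i) (w i)} \<inter> {lev (u j) (v j), lev (v j) (w j)} = {}"
      if ij: "i < j" "j < m" for i j
    proof -
      have "i < m"
        using ij by simp
      note i = tr(1)[OF this] and j = tr(1)[OF ij(2)] and s = tr(2)[OF ij]
      have "v i < w i" "v i < u j" "w i < v j"
        using i j s by auto
      then have "lev p q \<noteq> lev y z" if "(p, q) \<in> {(u i, v i), (v i, w i)}" "(y, z) \<in> {(u j, v j), (v j, w j)}" for p q y z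
        using that i j s A(3) unfolding distinct_levels_def by auto
      then show ?thesis
        by auto
    qed
    show ?thesis
      using *[of i j] *[of j i] tr(3-5) by (metis Int_commute linorder_neqE_nat)
  qed
  \<comment> \<open>The half with \<open>N\<close> levels below the cut supplies the tail
    \<open>b\<close> of the arcs, and the other half supplies the pairs above the cut.\<close>
  from median_split[OF finite_levels[OF fin(1)] finite_levels[OF fin(2)] lev]
  consider (right) t where "N \<le> card {l \<in> levels L. l \<le> t}" "N \<le> card {l \<in> levels R. t < l}"
    | (left) t where "N \<le> card {l \<in> levels R. l \<le> t}" "N \<le> card {l \<in> levels L. t < l}"
    by blast
  then show False
  proof cases
    case right
    obtain Y where Y: "Y \<subseteq> R" "N \<le> card Y" "\<And>x y. x \<in> Y \<Longrightarrow> y \<in> Y \<Longrightarrow> x < y \<Longrightarrow> t < lev x y"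
      using upper[OF LR(2) right(2)] by blast
    have YA: "Y \<subseteq> A" "finite Y"
      using Y(1) LR(2) fin(2) finite_subset by auto
    have triple: "\<exists>u\<in>W. \<exists>v\<in>W. \<exists>w\<in>W. u < v \<and> v < w \<and> lev u v < lev v w"
      if "W \<subseteq> Y" "card W = 6 * m + 1" for W
    proof (rule not_right_comb_triple, rule notI)
      assume W: "right_comb W"
      have WA: "W \<subseteq> A"
        using that(1) YA by blast
      have "card W \<le> 6 * m"
        using card_right_comb_le[OF mix red_free_subset[OF free WA] _ W] levels_mono[OF WA] A(2)
          finite_subset[OF WA A(1)] by blast
      then show False
        using that(2) by simp
    qed
    from obtain_separated_triples[OF YA(2) Y(2)[unfolded N_def], of "\<lambda>u v w. lev u v < lev v w", OF triple]
    obtain u v w where uvw: "\<And>i. i < m \<Longrightarrow> {u i, v i, w i} \<subseteq> Y \<and> u i < v i \<and> v i < w i \<and> lev (u i) (v i) < lev (v i) (w i)"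
      and sep: "\<And>i j. i < j \<Longrightarrow> j < m \<Longrightarrow> w i < u j"
      by blast
    have levU: "lev (u i) (v i) \<in> U" "lev (v i) (w i) \<in> U" if "i < m" for i
      using uvw[OF that] subsetD[OF YA(1)] by (auto intro!: subsetD[OF A(2)] levelsI)
    have "\<exists>b\<in>{l \<in> levels L. l \<le> t}. \<exists>i\<in>{..<m}. lev (v i) (w i) \<in> \<phi> b \<and> lev (u i) (v i) \<notin> \<phi> b"
    proof (rule mixing_indexed[OF mix lowerU[OF LR(1)]])
      show "m \<le> card {l \<in> levels L. l \<le> t}"
        using right(1) mN by simp
      show "m \<le> card {..<m}"
        by simp
      show "(\<lambda>i. lev (v i) (w i)) ` {..<m} \<subseteq> U" "(\<lambda>i. lev (u i) (v i)) ` {..<m} \<subseteq> U"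
        using levU by auto
      show "lev (v i) (w i) \<noteq> lev (u i) (v i)" if "i \<in> {..<m}" for i
        using uvw[of i] that by simp
      show "{lev (v i) (w i), lev (u i) (v i)} \<inter> {lev (v j) (w j), lev (u j) (v j)} = {}"
        if "i \<in> {..<m}" "j \<in> {..<m}" "i \<noteq> j" for i j
        using dis[of u v w i j] uvw sep YA(1) that by (simp add: insert_commute subset_iff)
    qed
    then obtain b i where b: "b \<in> levels L" "b \<le> t" and i: "i < m" "lev (v i) (w i) \<in> \<phi> b" "lev (u i) (v i) \<notin> \<phi> b"
      by auto
    obtain p q where pq: "p \<in> L" "q \<in> L" "p < q" "b = lev p q"
      using b(1) by (auto simp: levels_def)
    have Ys: "u i \<in> Y" "v i \<in> Y" "w i \<in> Y" "u i < v i" "v i < w i" "lev (u i) (v i) < lev (v i) (w i)"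
      using uvw[OF i(1)] by simp_all
    have "t < lev (u i) (v i)"
      using Y(3) Ys by simp
    moreover have "lev (v i) (w i) < a"
      using rr Ys Y(1) by blast
    moreover have "q < u i" "lev q (u i) = a"
      using lr[OF pq(2)] Ys(1) Y(1) by auto
    \<comment> \<open>Here \<open>lev p q\<close> is below both levels of the triple and
      \<open>a\<close> is above them, so the fourth case of \<open>red_levels\<close>
      applies.\<close>
    ultimately have "red_levels \<phi> (lev p q) (lev q (u i)) (lev (u i) (v i)) (lev (v i) (w i))"
      unfolding red_levels_def using i(2,3) b(2) Ys(6) pq(4) by simp
    then show False
      using red_freeD[OF free, of p q "u i" "v i" "w i"] Ys pq \<open>q < u i\<close> LR(1) YA(1) by auto
  next
    \<comment> \<open>Mirror case: the triples lie in \<open>L\<close>, the low level comes from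
      \<open>R\<close>, and the last case of \<open>red_levels\<close> applies.\<close>
    case left
    obtain Y where Y: "Y \<subseteq> L" "N \<le> card Y" "\<And>x y. x \<in> Y \<Longrightarrow> y \<in> Y \<Longrightarrow> x < y \<Longrightarrow> t < lev x y"
      using upper[OF LR(1) left(2)] by blast
    have YA: "Y \<subseteq> A" "finite Y"
      using Y(1) LR(1) fin(1) finite_subset by auto
    have triple: "\<exists>u\<in>W. \<exists>v\<in>W. \<exists>w\<in>W. u < v \<and> v < w \<and> lev v w < lev u v"
      if "W \<subseteq> Y" "card W = 6 * m + 1" for W
    proof (rule not_left_comb_triple, rule notI)
      assume W: "left_comb W"
      have WA: "W \<subseteq> A"
        using that(1) YA by blast
      have "card W \<le> 6 * m"
        using card_left_comb_le[OF mix red_free_subset[OF free WA] _ W] levels_mono[OF WA] A(2)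
          finite_subset[OF WA A(1)] by blast
      then show False
        using that(2) by simp
    qed
    from obtain_separated_triples[OF YA(2) Y(2)[unfolded N_def], of "\<lambda>u v w. lev v w < lev u v", OF triple]
    obtain u v w where uvw: "\<And>i. i < m \<Longrightarrow> {u i, v i, w i} \<subseteq> Y \<and> u i < v i \<and> v i < w i \<and> lev (v i) (w i) < lev (u i) (v i)"
      and sep: "\<And>i j. i < j \<Longrightarrow> j < m \<Longrightarrow> w i < u j"
      by blast
    have levU: "lev (u i) (v i) \<in> U" "lev (v i) (w i) \<in> U" if "i < m" for i
      using uvw[OF that] subsetD[OF YA(1)] by (auto intro!: subsetD[OF A(2)] levelsI)
    have "\<exists>b\<in>{l \<in> levels R. l \<le> t}. \<exists>i\<in>{..<m}. lev (u i) (v i) \<in> \<phi> b \<and> lev (v i) (w i) \<notin> \<phi> b"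
    proof (rule mixing_indexed[OF mix lowerU[OF LR(2)]])
      show "m \<le> card {l \<in> levels R. l \<le> t}"
        using left(1) mN by simp
      show "m \<le> card {..<m}"
        by simp
      show "(\<lambda>i. lev (v i) (w i)) ` {..<m} \<subseteq> U" "(\<lambda>i. lev (u i) (v i)) ` {..<m} \<subseteq> U"
        using levU by auto
      show "lev (u i) (v i) \<noteq> lev (v i) (w i)" if "i \<in> {..<m}" for i
        using uvw[of i] that by simp
      show "{lev (u i) (v i), lev (v i) (w i)} \<inter> {lev (u j) (v j), lev (v j) (w j)} = {}"
        if "i \<in> {..<m}" "j \<in> {..<m}" "i \<noteq> j" for i j
        using dis[of u v w i j] uvw sep YA(1) that by (simp add: subset_iff)
    qed
    then obtain b i where b: "b \<in> levels R" "b \<le> t" and i: "i < m" "lev (u i) (v i) \<in> \<phi> b" "lev (v i) (w i) \<notin> \<phi> b"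
      by auto
    obtain p q where pq: "p \<in> R" "q \<in> R" "p < q" "b = lev p q"
      using b(1) by (auto simp: levels_def)
    have Ys: "u i \<in> Y" "v i \<in> Y" "w i \<in> Y" "u i < v i" "v i < w i" "lev (v i) (w i) < lev (u i) (v i)"
      using uvw[OF i(1)] by simp_all
    have "t < lev (v i) (w i)"
      using Y(3) Ys by simp
    moreover have "lev (u i) (v i) < a"
      using ll Ys Y(1) by blast
    moreover have "w i < p" "lev (w i) p = a"
      using lr[OF _ pq(1)] Ys(3) Y(1) by auto
    ultimately have "red_levels \<phi> (lev (u i) (v i)) (lev (v i) (w i)) (lev (w i) p) (lev p q)"
      unfolding red_levels_def using i(2,3) b(2) Ys(6) pq(4) by simp
    then show False
      using red_freeD[OF free, of "u i" "v i" "w i" p q] Ys pq \<open>w i < p\<close> LR(2) YA(1) by auto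
  qed
qed

text \<open>The outer factor \<open>6 * m + 1\<close> pays for distinct levels. What remains has no
  splitting with two large halves, and its two combs have at most \<open>6 * m\<close> vertices
  each, whence \<open>12 * m\<close>.\<close>

lemma card_red_free_less:
  assumes mix: "mixing U m \<phi>" and free: "red_free \<phi> A" and A: "finite A" "levels A \<subseteq> U"
  shows "card A < (12 * m * (2 * (m * (6 * m + 1)) + 1) + 1) * (6 * m + 1)"
proof (rule ccontr)
  let ?k = "2 * (m * (6 * m + 1)) + 1"
  assume "\<not> ?thesis"
  then have "(12 * m * ?k + 1) * (6 * m + 1) \<le> card A"
    by simp
  from distinct_levels_subset_exists[OF mix free A this]
  obtain X where X: "X \<subseteq> A" "card X = 12 * m * ?k + 1" "distinct_levels X"
    by blast
  have fX: "finite X" "X \<noteq> {}"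
    using finite_subset[OF X(1) A(1)] X(2) by auto
  have lX: "levels X \<subseteq> U" and rX: "red_free \<phi> X"
    using levels_mono[OF X(1)] A(2) red_free_subset[OF free X(1)] by simp_all
  from balanced_split_or_combs[OF fX, of ?k] consider
    (split) Y L R a where "Y \<subseteq> X" "splits Y L R a" "?k \<le> card L" "?k \<le> card R"
    | (combs) C D where "C \<subseteq> X" "D \<subseteq> X" "right_comb C" "left_comb D" "card X \<le> (card C + card D) * ?k"
    by (metis zero_less_Suc Suc_eq_plus1)
  then show False
  proof cases
    case split
    then show False
      using no_balanced_split[OF mix rX fX(1) lX X(3) split(2,1)] by simp
  next
    case combs
    have "card C \<le> 6 * m"
      using card_right_comb_le[OF mix red_free_subset[OF rX combs(1)] finite_subset[OF combs(1) fX(1)] combs(3)]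
        levels_mono[OF combs(1)] lX by blast
    moreover have "card D \<le> 6 * m"
      using card_left_comb_le[OF mix red_free_subset[OF rX combs(2)] finite_subset[OF combs(2) fX(1)] combs(4)]
        levels_mono[OF combs(2)] lX by blast
    ultimately have "(card C + card D) * ?k \<le> 12 * m * ?k"
      by (intro mult_le_mono1) simp
    then show False
      using combs(5) X(2) by simp
  qed
qed

subsection \<open>The lower bound\<close>

lemma sparse_colouring_exists:
  assumes "0 < k"
  shows "\<exists>\<phi>. \<forall>A \<subseteq> {..<2 ^ (2 ^ k)}. red_free \<phi> A \<longrightarrow> card A < (50 * k) ^ 4"
proof -
  obtain \<phi> where \<phi>: "mixing {1..2 ^ k :: nat} (8 * k) \<phi>"
    using mixing_exists[of "{1..2 ^ k :: nat}" k] assms by fastforce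
  have "card A < (50 * k) ^ 4" if A: "A \<subseteq> {..<2 ^ (2 ^ k)}" "red_free \<phi> A" for A
  proof -
    have "lev x y \<in> {1..2 ^ k}" if "x \<in> A" "y \<in> A" "x < y" for x y
      using A(1) that lev_pos[of x y] lev_le_exp[of x "2 ^ k" y] by auto
    then have "levels A \<subseteq> {1..2 ^ k}"
      by (auto simp: levels_def)
    then have "card A < (12 * (8 * k) * (2 * (8 * k * (6 * (8 * k) + 1)) + 1) + 1) * (6 * (8 * k) + 1)"
      using card_red_free_less[OF \<phi> A(2)] A(1) finite_subset by blast
    \<comment> \<open>Each added 1 is absorbed into the power of \<open>k\<close>. The constants are
      \<open>785 = 2 * 392 + 1\<close> and \<open>75361 = 96 * 785 + 1\<close>, and
      \<open>75361 * 49 < 50 ^ 4\<close>.\<close>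
    also have "\<dots> \<le> (75361 * k ^ 3) * (49 * k)"
    proof (rule mult_le_mono)
      have k1: "1 \<le> k" "1 \<le> k ^ 2" "1 \<le> k ^ 3"
        using assms by (simp_all add: Suc_le_eq)
      have "8 * k * (6 * (8 * k) + 1) \<le> 8 * k * (49 * k)"
        using k1 by (intro mult_le_mono2) simp
      also have "\<dots> = 392 * k ^ 2"
        by (simp add: power2_eq_square)
      finally have "2 * (8 * k * (6 * (8 * k) + 1)) + 1 \<le> 785 * k ^ 2"
        using k1(2) by linarith
      then have "12 * (8 * k) * (2 * (8 * k * (6 * (8 * k) + 1)) + 1) \<le> 12 * (8 * k) * (785 * k ^ 2)"
        by (rule mult_le_mono2)
      also have "\<dots> = 75360 * k ^ 3"
        by (simp add: power2_eq_square power3_eq_cube)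
      finally show "12 * (8 * k) * (2 * (8 * k * (6 * (8 * k) + 1)) + 1) + 1 \<le> 75361 * k ^ 3"
        using k1(3) by linarith
      show "6 * (8 * k) + 1 \<le> 49 * k"
        using k1 by simp
    qed
    also have "\<dots> \<le> (50 * k) ^ 4"
      by (simp add: power_mult_distrib power4_eq_xxxx power3_eq_cube)
    finally show ?thesis .
  qed
  then show ?thesis
    by blast
qed

section \<open>Numerical estimates for the double exponent\<close>

text \<open>Below \<open>50 ^ 4\<close> the constant \<open>1 / 100\<close> keeps the innermost
  exponent at most \<open>1 / 2\<close>; then \<open>sqrt 2 < 3 / 2\<close> and
  \<open>2 powr (3 / 2) = sqrt 8 < 3\<close>. So for small \<open>n\<close> three vertices are
  enough.\<close>

lemma double_exponent_small:
  assumes "n < 50 ^ 4"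
  shows "2 powr (2 powr (1 / 100 * real n powr (1 / 4))) < 3"
proof -
  have "real n < real (50 ^ 4)"
    using assms by (simp only: of_nat_less_iff)
  also have "real (50 ^ 4) = 50 powr 4"
    by simp
  finally have "real n powr (1 / 4) \<le> (50 powr 4) powr (1 / 4)"
    by (intro powr_mono2) simp_all
  also have "\<dots> = 50"
    by (simp only: powr_powr) simp
  finally have "2 powr (1 / 100 * real n powr (1 / 4)) \<le> 2 powr (1 / 2)"
    by (intro powr_mono) simp_all
  also have "\<dots> < 3 / 2"
  proof -
    have "sqrt 2 < 3 / 2"
      by (rule real_less_lsqrt) (simp_all add: power2_eq_square)
    then show ?thesis
      by (simp only: powr_half_sqrt)
  qed
  finally have "2 powr (2 powr (1 / 100 * real n powr (1 / 4))) < 2 powr (3 / 2)"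
    by (intro powr_less_mono) simp_all
  also have "\<dots> = sqrt 8"
  proof -
    have "2 powr (3 / 2) = (2 powr 3) powr (1 / 2 :: real)"
      by (simp only: powr_powr) simp
    then show ?thesis
      by (simp add: powr_half_sqrt)
  qed
  also have "\<dots> < 3"
    by (rule real_less_lsqrt) simp_all
  finally show ?thesis .
qed

text \<open>With \<open>x\<close> the fourth root of \<open>n\<close> and \<open>k\<close> the
  integer part of \<open>x / 50\<close>, \<open>x / 50 < k + 1 <= 2 * k\<close>. Rounding costs at
  most a factor 2, which turns \<open>1 / 50\<close> into \<open>1 / 100\<close>.\<close>

lemma double_exponent_large:
  assumes "50 ^ 4 \<le> n"
  obtains k where "0 < k" "(50 * k) ^ 4 \<le> n"
    "2 powr (2 powr (1 / 100 * real n powr (1 / 4))) < 2 ^ (2 ^ k)"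
proof -
  define x where "x = real n powr (1 / 4)"
  define k where "k = nat \<lfloor>x / 50\<rfloor>"
  have n: "real n \<ge> 50 ^ 4"
  proof -
    have "real (50 ^ 4) \<le> real n"
      using assms by (simp only: of_nat_le_iff)
    then show ?thesis
      by simp
  qed
  have x4: "x ^ 4 = real n"
  proof -
    have "0 < real n"
      by (rule less_le_trans[OF _ n]) simp
    then have "x ^ 4 = x powr real 4"
      unfolding x_def by (subst powr_realpow) simp_all
    also have "\<dots> = real n powr 1"
      unfolding x_def by (simp only: powr_powr) simp
    finally show ?thesis
      by simp
  qed
  have x: "50 \<le> x"
  proof (rule ccontr)
    assume "\<not> 50 \<le> x"
    then have "x ^ 4 < 50 ^ 4"
      by (intro power_strict_mono) (simp_all add: x_def)
    then show False
      using x4 n by simp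
  qed
  have k: "real k \<le> x / 50" "x / 50 < real k + 1"
    using x by (simp_all add: k_def of_nat_nat) linarith
  have "1 \<le> x / 50"
    using x by simp
  then have "1 \<le> k"
    by (simp add: k_def le_nat_iff)
  have "real ((50 * k) ^ 4) = (50 * real k) ^ 4"
    by simp
  also have "\<dots> \<le> x ^ 4"
    using k by (intro power_mono) simp_all
  finally have k4: "(50 * k) ^ 4 \<le> n"
    by (simp only: x4 of_nat_le_iff)
  have "2 powr (2 powr (1 / 100 * x)) < 2 ^ (2 ^ k)"
  proof -
    have "1 / 100 * x < real k"
      using k(2) \<open>1 \<le> k\<close> by linarith
    then have "2 powr (1 / 100 * x) < (2 :: real) ^ k"
      by (simp add: powr_realpow[symmetric])
    then have "2 powr (2 powr (1 / 100 * x)) < (2 :: real) powr real (2 ^ k)"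
      by simp
    then show ?thesis
      by (simp only: powr_realpow zero_less_numeral)
  qed
  with k4 show ?thesis
    unfolding x_def using \<open>1 \<le> k\<close> by (intro that) simp_all
qed

section \<open>Passage to Ramsey numbers and independence numbers\<close>

lemma ramsey_number_ge:
  assumes "t \<le> k + 1" "\<And>N. N < N0 \<Longrightarrow> \<not> ramsey_property k t n N"
  shows "N0 \<le> ramsey_number k t n"
proof -
  have "ramsey_property k t n (ramsey_number k t n)"
    using LeastI_ex[OF ramsey_property_exists[OF assms(1)]] by (simp add: ramsey_number_def)
  then show ?thesis
    using assms(2) not_le by blast
qed

lemma not_ramsey_property_sparse:
  assumes "\<And>A. A \<subseteq> {..<M} \<Longrightarrow> red_free \<phi> A \<Longrightarrow> card A < n" "N < M"
  shows "\<not> ramsey_property 5 4 n N"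
proof
  define \<chi> where "\<chi> e = (if red_set \<phi> e then Red else Blue)" for e
  assume "ramsey_property 5 4 n N"
  then consider S where "S \<in> nsets {1..N} 6" "4 \<le> card {e \<in> nsets S 5. \<chi> e = Red}"
    | S where "S \<in> nsets {1..N} n" "\<And>e. e \<in> nsets S 5 \<Longrightarrow> \<chi> e = Blue"
    unfolding ramsey_property_def by (auto dest!: spec[of _ \<chi>])
  then show False
  proof cases
    case 1
    have "{e \<in> nsets S 5. \<chi> e = Red} = {e. e \<subseteq> S \<and> red_set \<phi> e}"
      using red_set_card by (auto simp: \<chi>_def nsets_def)
    then show False
      using 1 card_red_sets_le[of S \<phi>] by (simp add: nsets_def)
  next
    case 2
    \<comment> \<open>The colouring lives on vertices from 0 and the Ramsey property on
      \<open>{1..N}\<close>; \<open>N < M\<close> makes the latter fit.\<close>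
    have "S \<subseteq> {..<M}"
      using 2(1) assms(2) by (auto simp: nsets_def)
    moreover have "red_free \<phi> S"
      unfolding red_free_def
    proof (intro allI impI notI)
      fix e assume "e \<subseteq> S" "red_set \<phi> e"
      then have "\<chi> e = Blue" "\<chi> e = Red"
        using 2(2)[of e] red_set_card[of \<phi> e] by (auto simp: nsets_def \<chi>_def)
      then show False
        by simp
    qed
    ultimately show False
      using assms(1)[of S] 2(1) by (simp add: nsets_def)
  qed
qed

text \<open>\<open>Max\<close> is informative only for a finite nonempty set. The empty set is
  independent because \<open>{}\<close> is not an edge.\<close>

lemma independence_number_less:
  assumes "finite V" "{} \<notin> E" "\<And>S. independent_set V E S \<Longrightarrow> card S < n"
  shows "independence_number V E < n"
proof -
  have "{S. independent_set V E S} \<subseteq> Pow V"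
    by (auto simp: independent_set_def)
  then have fin: "finite (card ` {S. independent_set V E S})"
    using assms(1) by (meson finite_Pow_iff finite_imageI finite_subset)
  have "independent_set V E {}"
    using assms(2) by (auto simp: independent_set_def induced_edges_def)
  then have "card ` {S. independent_set V E S} \<noteq> {}"
    by blast
  then show ?thesis
    unfolding independence_number_def using Max_in[OF fin] assms(3) by auto
qed

text \<open>Sets with fewer than five elements are vacuously blue or independent. Hence the Ramsey
  number for \<open>n = 2\<close> is 2, and a hypergraph for \<open>n = 3\<close> has at most two
  vertices, while the bound always exceeds 2. This explains the two thresholds for
  \<open>n\<close>.\<close>

theorem theorem4:
  shows "\<exists>c::real. c > 0 \<and>
    (\<forall>n::nat. n > 2 \<longrightarrow>
       real (ramsey_number 5 4 n) > 2 powr (2 powr (c * real n powr (1 / 4)))) \<and>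
    (\<forall>n::nat. n > 3 \<longrightarrow>
       (\<exists>(V :: nat set) E.
          uniform_hypergraph 5 V E \<and>
          real (card V) > 2 powr (2 powr (c * real n powr (1 / 4))) \<and>
          independence_number V E < n \<and>
          (\<forall>S \<in> nsets V 6. card (induced_edges E S) \<le> 3)))"
proof (intro exI[of _ "1 / 100"] conjI allI impI)
  fix n :: nat assume n: "n > 2"
  show "real (ramsey_number 5 4 n) > 2 powr (2 powr (1 / 100 * real n powr (1 / 4)))"
  proof (cases "n < 50 ^ 4")
    case True
    \<comment> \<open>Two points contain neither a 6-set nor an \<open>n\<close>-set, so both
      alternatives fail for every colouring.\<close>
    have "\<not> ramsey_property 5 4 n N" if "N < 3" for N
    proof -
      have "nsets {1..N} 6 = {}" "nsets {1..N} n = {}"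
        using that n by (simp_all add: nsets_eq_empty_iff)
      then show ?thesis
        by (simp add: ramsey_property_def)
    qed
    then have "3 \<le> ramsey_number 5 4 n"
      by (intro ramsey_number_ge) simp_all
    then show ?thesis
      using double_exponent_small[OF True] by linarith
  next
    case False
    then have "50 ^ 4 \<le> n"
      by (rule leI)
    from double_exponent_large[OF this] obtain k where k: "0 < k" "(50 * k) ^ 4 \<le> n"
      "2 powr (2 powr (1 / 100 * real n powr (1 / 4))) < 2 ^ (2 ^ k)"
      by blast
    obtain \<phi> where \<phi>: "\<And>A. A \<subseteq> {..<2 ^ (2 ^ k)} \<Longrightarrow> red_free \<phi> A \<Longrightarrow> card A < (50 * k) ^ 4"
      using sparse_colouring_exists[OF k(1)] by blast
    have "2 ^ (2 ^ k) \<le> ramsey_number 5 4 n"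
    proof (rule ramsey_number_ge)
      fix N :: nat assume "N < 2 ^ (2 ^ k)"
      with less_le_trans[OF \<phi> k(2)] show "\<not> ramsey_property 5 4 n N"
        by (rule not_ramsey_property_sparse)
    qed simp
    then have "2 ^ (2 ^ k) \<le> real (ramsey_number 5 4 n)"
      by (metis of_nat_le_iff of_nat_numeral of_nat_power)
    then show ?thesis
      using k(3) by linarith
  qed
next
  fix n :: nat assume n: "n > 3"
  show "\<exists>(V :: nat set) E. uniform_hypergraph 5 V E \<and>
      real (card V) > 2 powr (2 powr (1 / 100 * real n powr (1 / 4))) \<and>
      independence_number V E < n \<and> (\<forall>S \<in> nsets V 6. card (induced_edges E S) \<le> 3)"
  proof (cases "n < 50 ^ 4")
    case True
    \<comment> \<open>The edgeless hypergraph on \<open>n - 1\<close> vertices suffices: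
      \<open>n > 3\<close> gives it at least three vertices.\<close>
    have "independence_number {..<n - 1} {} < n"
    proof (rule independence_number_less)
      fix S assume "independent_set {..<n - 1} {} S"
      then have "card S \<le> card {..<n - 1}"
        by (intro card_mono) (simp_all add: independent_set_def)
      then show "card S < n"
        using n by simp
    qed simp_all
    moreover have "real (card {..<n - 1}) > 2 powr (2 powr (1 / 100 * real n powr (1 / 4)))"
      using double_exponent_small[OF True] n by simp
    ultimately show ?thesis
      by (intro exI[of _ "{..<n - 1}"] exI[of _ "{}"]) (simp add: uniform_hypergraph_def induced_edges_def)
  next
    case False
    then have "50 ^ 4 \<le> n"
      by (rule leI)
    from double_exponent_large[OF this] obtain k where k: "0 < k" "(50 * k) ^ 4 \<le> n"
      "2 powr (2 powr (1 / 100 * real n powr (1 / 4))) < 2 ^ (2 ^ k)"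
      by blast
    obtain \<phi> where \<phi>: "\<And>A. A \<subseteq> {..<2 ^ (2 ^ k)} \<Longrightarrow> red_free \<phi> A \<Longrightarrow> card A < (50 * k) ^ 4"
      using sparse_colouring_exists[OF k(1)] by blast
    define V :: "nat set" where "V = {..<2 ^ (2 ^ k)}"
    define E where "E = {e. e \<subseteq> V \<and> red_set \<phi> e}"
    have "uniform_hypergraph 5 V E"
      using red_set_card by (auto simp: uniform_hypergraph_def E_def V_def nsets_def)
    moreover have "real (card V) > 2 powr (2 powr (1 / 100 * real n powr (1 / 4)))"
      using k(3) by (simp add: V_def)
    moreover have "independence_number V E < n"
    proof (rule independence_number_less)
      show "finite V" "{} \<notin> E"
        using red_set_card[of \<phi> "{}"] by (auto simp: V_def E_def)
      fix S assume "independent_set V E S"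
      then have "S \<subseteq> V" "red_free \<phi> S"
        by (auto simp: independent_set_def induced_edges_def red_free_def E_def)
      then show "card S < n"
        using \<phi>[of S] k(2) by (simp add: V_def)
    qed
    moreover have "card (induced_edges E S) \<le> 3" if "S \<in> nsets V 6" for S
    proof -
      have "induced_edges E S = {e. e \<subseteq> S \<and> red_set \<phi> e}" "finite S" "card S = 6"
        using that by (auto simp: induced_edges_def E_def nsets_def)
      then show ?thesis
        using card_red_sets_le[of S \<phi>] by simp
    qed
    ultimately show ?thesis
      by blast
  qed
qed simp

end
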